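(* Let $0<\beta^2<4\pi$, $\nu=\beta^2/(8\pi-\beta^2)\in(0,1)$ and $m>0$. For $n\ge 0$ let $f_n^{\varphi}(\theta_1,\dots,\theta_n)$ and $f_n^{\sin\beta\varphi}(\theta_1,\dots,\theta_n)$ denote the $n$-particle form factors (for the fundamental boson of mass $m$, i.e. the lowest breather) of the sine-Gordon field $\varphi$ and of $\mathcal N\sin\beta\varphi$, as defined in the context. Then the quantum sine-Gordon field equation $$\Box\varphi+\frac{\alpha}{\beta}\,\mathcal N\sin\beta\varphi=0$$ is fulfilled for all matrix elements if $$\alpha=m^2\,\frac{\pi\nu}{\sin\pi\nu}.$$ That is, with this value of $\alpha$, for every $n\ge 0$, identically as meromorphic functions of $(\theta_1,\dots,\theta_n)\in\mathbb C^n$, $$-m^2\Big(\sum_{i=1}^n e^{\theta_i}\Big)\Big(\sum_{i=1}^n e^{-\theta_i}\Big)f_n^{\varphi}(\theta_1,\dots,\theta_n)+\frac{\alpha}{\beta}\,f_n^{\sin\beta\varphi}(\theta_1,\dots,\theta_n)=0 .$$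
   Context: Throughout $\theta_{ij}=\theta_i-\theta_j$ and $\underline\theta=(\theta_1,\dots,\theta_n)$. A particle with rapidity $\theta$ has momentum $p^\pm=p^0\pm p^1=m e^{\pm\theta}$. The form factor $f_n^{\mathcal O}$ of a local operator $\mathcal O$ is defined by $\langle 0|\mathcal O(x)|p_1,\dots,p_n\rangle^{in}=e^{-ix\cdot(p_1+\dots+p_n)}f_n^{\mathcal O}(\underline\theta)$ for $\theta_1>\dots>\theta_n$ and continued meromorphically; hence $\Box=\partial_t^2-\partial_x^2$ acts on form factors as multiplication by $-(p_1+\dots+p_n)^2=-m^2\sum_i e^{\theta_i}\sum_i e^{-\theta_i}$, and a linear operator equation "for all matrix elements" means the corresponding equation between the functions $f_n$ for all $n$. Two-particle function. $F(\theta)$ is the meromorphic continuation of $$F(\theta)=N\exp\int_0^\infty\frac{dt}{t}\,\frac{\big(\cosh\frac12 t-\cosh(\frac12+\nu)t\big)\big(1-\cosh t(1-\frac{\theta}{i\pi})\big)}{\cosh\frac12 t\,\sinh t},$$ with the constant $N$ normalized such that $F(\infty)=1$ (limit $\mathrm{Re}\,\theta\to\infty$). It satisfies $F(\theta)=F(-\theta)S(\theta)=F(2\pi i-\theta)$ with $S(\theta)=\frac{\sinh\theta+i\sin\pi\nu}{\sinh\theta-i\sin\pi\nu}$. General form. For $n\ge1$, $$f_n^{\mathcal O}(\underline\theta)=N_n^{\mathcal O}\,K_n^{\mathcal O}(\underline\theta)\prod_{1\le i<j\le n}F(\theta_{ij}),$$ $$K_n^{\mathcal O}(\underline\theta)=\sum_{l_1=0}^1\cdots\sum_{l_n=0}^1(-1)^{l_1+\dots+l_n}\prod_{1\le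 i<j\le n}\Big(1+(l_i-l_j)\frac{i\sin\pi\nu}{\sinh\theta_{ij}}\Big)\,p_n^{\mathcal O},$$ where the "p-function" $p_n^{\mathcal O}$ (which may depend on $l_1,\dots,l_n$ and $\underline\theta$) encodes the operator. Wave function renormalization constant: $$Z^\varphi=(1+\nu)\,\frac{\frac{\pi}{2}\nu}{\sin\frac{\pi}{2}\nu}\exp\Big(-\frac1\pi\int_0^{\pi\nu}\frac{t}{\sin t}\,dt\Big).$$ Operators. (1) Exponentials $\mathcal N e^{i\gamma\varphi}$, $\gamma\in\mathbb R$ ($\mathcal N$ denotes normal ordering with respect to the physical vacuum): $p_n=\prod_{i=1}^n e^{(2l_i-1)i\pi\nu\gamma/\beta}$, $N_n=\big(\sqrt{Z^\varphi}\,\frac{\beta}{2\pi\nu}\big)^n$ for $n\ge1$, and $f_0=1$. (2) $\mathcal N\sin\beta\varphi$: $f_n^{\sin\beta\varphi}=\frac1{2i}\big(f_n^{e^{i\beta\varphi}}-f_n^{e^{-i\beta\varphi}}\big)$. (3) The field $\varphi$: $p_n=\sum_{i=1}^n(2l_i-1)$, $N_n=\frac{\sqrt{Z^\varphi}}{2}\big(\sqrt{Z^\varphi}\,\frac{\beta}{2\pi\nu}\big)^{n-1}$ for $n\ge1$, and $f_0^\varphi=0$. *)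

theory Defs
  imports "HOL-Complex_Analysis.Complex_Analysis"
begin

definition nu :: "real \<Rightarrow> real" where
  "nu \<beta> = \<beta>\<^sup>2 / (8 * pi - \<beta>\<^sup>2)"

definition F_integrand :: "real \<Rightarrow> complex \<Rightarrow> real \<Rightarrow> complex" where
  "F_integrand \<nu> \<theta> t =
     complex_of_real (1 / t)
     * ((complex_of_real (cosh (t / 2) - cosh ((1 / 2 + \<nu>) * t))
         * (1 - cosh (complex_of_real t * (1 - \<theta> / (\<i> * complex_of_real pi)))))
        / complex_of_real (cosh (t / 2) * sinh t))"

text \<open>
  For \<open>0 < \<nu> < 1\<close> the integral below converges absolutely exactly for
  \<open>\<bar>1 - Im \<theta> / \<pi>\<bar> < 1 - \<nu>\<close>, i.e. on the open strip \<open>\<pi>\<nu> < Im \<theta> < 2\<pi> - \<pi>\<nu>\<close>, which does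
  not contain the real rapidities.  So \<open>F\<close> has to be defined by continuation.  Being
  nicely meromorphic fixes the value of \<open>F\<close> at its poles (to 0) and excludes removable
  singularities, which makes the continuation unique as a total function.
\<close>

definition F_strip :: "real \<Rightarrow> complex set" where
  "F_strip \<nu> = {\<theta>. pi * \<nu> < Im \<theta> \<and> Im \<theta> < 2 * pi - pi * \<nu>}"

definition is_F :: "real \<Rightarrow> (complex \<Rightarrow> complex) \<Rightarrow> bool" where
  "is_F \<nu> F \<longleftrightarrow>
     F nicely_meromorphic_on UNIV \<and>
     (\<exists>N. \<forall>\<theta>\<in>F_strip \<nu>. F \<theta> = N * exp (LINT t:{0<..}|lborel. F_integrand \<nu> \<theta> t)) \<and>
     (\<forall>y. pi * \<nu> < y \<and> y < 2 * pi - pi * \<nu> \<longrightarrow> ((\<lambda>x. F (Complex x y)) \<longlongrightarrow> 1) at_top)"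

definition F_min :: "real \<Rightarrow> complex \<Rightarrow> complex" where
  "F_min \<nu> = (THE F. is_F \<nu> F)"

text \<open>
  Rapidities are given as \<open>\<theta> :: nat \<Rightarrow> complex\<close>, of which only \<open>\<theta> 1, \<dots>, \<theta> n\<close> are used.  The
  p-function receives the summation indices \<open>l\<close> and the rapidities.
\<close>

type_synonym p_function = "(nat \<Rightarrow> nat) \<Rightarrow> (nat \<Rightarrow> complex) \<Rightarrow> complex"

definition K_fun :: "real \<Rightarrow> nat \<Rightarrow> p_function \<Rightarrow> (nat \<Rightarrow> complex) \<Rightarrow> complex" where
  "K_fun \<nu> n p \<theta> =
     (\<Sum>l \<in> {1..n} \<rightarrow>\<^sub>E {0, 1}.
        (- 1) ^ (\<Sum>i = 1..n. l i)
        * (\<Prod>i = 1..n. \<Prod>j \<in> {i<..n}.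
             1 + (of_nat (l i) - of_nat (l j))
                 * (\<i> * complex_of_real (sin (pi * \<nu>)) / sinh (\<theta> i - \<theta> j)))
        * p l \<theta>)"

definition general_form :: "real \<Rightarrow> nat \<Rightarrow> complex \<Rightarrow> p_function \<Rightarrow> (nat \<Rightarrow> complex) \<Rightarrow> complex" where
  "general_form \<nu> n N p \<theta> =
     N * K_fun \<nu> n p \<theta> * (\<Prod>i = 1..n. \<Prod>j \<in> {i<..n}. F_min \<nu> (\<theta> i - \<theta> j))"

definition Z_phi :: "real \<Rightarrow> real" where
  "Z_phi \<nu> =
     (1 + \<nu>) * ((pi / 2 * \<nu>) / sin (pi / 2 * \<nu>))
     * exp (- (1 / pi) * integral {0..pi * \<nu>} (\<lambda>t. t / sin t))"

definition p_exp :: "real \<Rightarrow> real \<Rightarrow> nat \<Rightarrow> p_function" where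
  "p_exp \<beta> \<gamma> n l \<theta> =
     (\<Prod>i = 1..n. exp ((2 * of_nat (l i) - 1) * \<i> * complex_of_real (pi * nu \<beta> * \<gamma> / \<beta>)))"

definition f_exp :: "real \<Rightarrow> real \<Rightarrow> nat \<Rightarrow> (nat \<Rightarrow> complex) \<Rightarrow> complex" where
  "f_exp \<beta> \<gamma> n \<theta> =
     (if n = 0 then 1
      else general_form (nu \<beta>) n
             (complex_of_real ((sqrt (Z_phi (nu \<beta>)) * (\<beta> / (2 * pi * nu \<beta>))) ^ n))
             (p_exp \<beta> \<gamma> n) \<theta>)"

definition f_sin :: "real \<Rightarrow> nat \<Rightarrow> (nat \<Rightarrow> complex) \<Rightarrow> complex" where
  "f_sin \<beta> n \<theta> = 1 / (2 * \<i>) * (f_exp \<beta> \<beta> n \<theta> - f_exp \<beta> (- \<beta>) n \<theta>)"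

definition p_phi :: "nat \<Rightarrow> p_function" where
  "p_phi n l \<theta> = (\<Sum>i = 1..n. 2 * of_nat (l i) - 1)"

definition f_phi :: "real \<Rightarrow> nat \<Rightarrow> (nat \<Rightarrow> complex) \<Rightarrow> complex" where
  "f_phi \<beta> n \<theta> =
     (if n = 0 then 0
      else general_form (nu \<beta>) n
             (complex_of_real (sqrt (Z_phi (nu \<beta>)) / 2
                * (sqrt (Z_phi (nu \<beta>)) * (\<beta> / (2 * pi * nu \<beta>))) ^ (n - 1)))
             (p_phi n) \<theta>)"

end

(*
  Put x_i = exp theta_i, q = exp (i pi nu) and w = q - 1/q. The factors F cancel, and since the
  p-functions depend on l only through the number of indices with l_i = 1, the field equation becomes

    sum_I (-1)^|I| prod_{i in I, j notin I} (1 + w x_i x_j / (x_i^2 - x_j^2))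
       * (q^k - q^(-k) - w (sum x_i) (sum 1/x_i) k) = 0,   k = 2|I| - n.

  As a function of one variable u = x_a, the left-hand side has possible simple poles only at
  u = +-x_r. At u = x_r the contributions of I and of I with a and r exchanged cancel. At u = -x_r,
  since 1 + w u y / (u^2 - y^2) at (-x_r, y) equals its value at (y, x_r), the residue is a multiple
  of the same expression without a and r, which vanishes by induction. The growth at infinity is
  controlled by the sum with weight 1 in the second line, which vanishes by the same argument, so the
  left-hand side is constant in each variable. The constant is found by letting two variables go to
  infinity along x_a = 1 - N, x_b = N: the limit is again a multiple of the expression in the
  remaining n - 2 variables.
*)
theory Submission
  imports Defs
begin

section \<open>Alternating sums over subsets\<close>

definition pair_factor :: "complex \<Rightarrow> complex \<Rightarrow> complex \<Rightarrow> complex" where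
  "pair_factor w a b = 1 + w * a * b / (a\<^sup>2 - b\<^sup>2)"

definition cross_prod :: "complex \<Rightarrow> ('i \<Rightarrow> complex) \<Rightarrow> 'i set \<Rightarrow> 'i set \<Rightarrow> complex" where
  "cross_prod w x I J = (\<Prod>i\<in>I. \<Prod>j\<in>J. pair_factor w (x i) (x j))"

text \<open>This is the algebraic form of \<open>K_fun\<close>: \<open>I\<close> collects the
  indices with l_i = 1, and the argument of \<open>h\<close> is the sum of all 2 l_i - 1.\<close>

definition subset_sum :: "complex \<Rightarrow> ('i \<Rightarrow> complex) \<Rightarrow> 'i set \<Rightarrow> (int \<Rightarrow> complex) \<Rightarrow> complex" where
  "subset_sum w x S h =
     (\<Sum>I\<in>Pow S. (- 1) ^ card I * cross_prod w x I (S - I) * h (2 * int (card I) - int (card S)))"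

text \<open>Exactly the condition under which the points x_i and -x_i, for i in \<open>S\<close>,
  are 2 |S| different nonzero numbers. In particular no denominator of a pair factor with different
  indices vanishes.\<close>

definition regular :: "('i \<Rightarrow> complex) \<Rightarrow> 'i set \<Rightarrow> bool" where
  "regular x S \<longleftrightarrow> (\<forall>i\<in>S. x i \<noteq> 0) \<and> inj_on (\<lambda>i. (x i)\<^sup>2) S"

text \<open>A reflection changes only the sign of the fraction, and so does exchanging the two
  arguments. This is what evaluates the residue at u = -x_r.\<close>

lemma pair_factor_minus: "pair_factor w (- a) b = pair_factor w b a" "pair_factor w b (- a) = pair_factor w a b"
proof -
  have "w * (- a) * b / (a\<^sup>2 - b\<^sup>2) = w * b * a / (b\<^sup>2 - a\<^sup>2)"
    using minus_divide_divide[of "w * a * b" "a\<^sup>2 - b\<^sup>2"]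
    by (metis (no_types, lifting) minus_diff_eq minus_divide_left minus_divide_right mult.assoc mult.commute mult_minus_left mult_minus_right)
  then show "pair_factor w (- a) b = pair_factor w b a" by (simp add: pair_factor_def)
  have "w * b * (- a) / (b\<^sup>2 - a\<^sup>2) = w * a * b / (a\<^sup>2 - b\<^sup>2)"
    by (metis (no_types, lifting) minus_diff_eq minus_divide_left minus_divide_right mult.assoc mult.commute mult_minus_left mult_minus_right)
  then show "pair_factor w b (- a) = pair_factor w a b" by (simp add: pair_factor_def)
qed

lemma sum_Pow_insert:
  assumes "a \<notin> S" "finite S"
  shows "(\<Sum>I\<in>Pow (insert a S). \<phi> I) = (\<Sum>I\<in>Pow S. \<phi> I + \<phi> (insert a I) :: 'b::comm_monoid_add)"
proof -
  have inj: "inj_on (insert a) (Pow S)"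
    using assms(1) by (auto simp: inj_on_def)
  have "(\<Sum>I\<in>Pow (insert a S). \<phi> I) = sum \<phi> (Pow S) + sum \<phi> (insert a ` Pow S)"
    unfolding Pow_insert using assms by (intro sum.union_disjoint) auto
  also have "sum \<phi> (insert a ` Pow S) = (\<Sum>I\<in>Pow S. \<phi> (insert a I))"
    using inj by (simp add: sum.reindex)
  finally show ?thesis by (simp add: sum.distrib)
qed

lemma cross_prod_insert_left:
  "finite I \<Longrightarrow> a \<notin> I \<Longrightarrow>
     cross_prod w x (insert a I) J = (\<Prod>j\<in>J. pair_factor w (x a) (x j)) * cross_prod w x I J"
  by (simp add: cross_prod_def)

lemma cross_prod_insert_right:
  "finite J \<Longrightarrow> a \<notin> J \<Longrightarrow>
     cross_prod w x I (insert a J) = (\<Prod>i\<in>I. pair_factor w (x i) (x a)) * cross_prod w x I J"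
  by (simp add: cross_prod_def prod.distrib)

lemma cross_prod_upd:
  "a \<notin> I \<Longrightarrow> a \<notin> J \<Longrightarrow> cross_prod w (x(a := u)) I J = cross_prod w x I J"
  unfolding cross_prod_def by (intro prod.cong) auto

text \<open>Split by whether \<open>a\<close> belongs to the subset: without \<open>a\<close> the
  index 2|I| - |S| drops by 1, with \<open>a\<close> it grows by 1 and the sign changes.\<close>

lemma subset_sum_insert:
  assumes "finite S" "a \<notin> S"
  shows "subset_sum w x (insert a S) h =
    (\<Sum>I\<in>Pow S. (- 1) ^ card I * cross_prod w x I (S - I) *
       (h (2 * int (card I) - int (card S) - 1) * (\<Prod>i\<in>I. pair_factor w (x i) (x a)) -
        h (2 * int (card I) - int (card S) + 1) * (\<Prod>j\<in>S - I. pair_factor w (x a) (x j))))"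
proof -
  have "(- 1) ^ card I * cross_prod w x I (insert a S - I) * h (2 * int (card I) - int (card (insert a S)))
     + (- 1) ^ card (insert a I) * cross_prod w x (insert a I) (insert a S - insert a I)
         * h (2 * int (card (insert a I)) - int (card (insert a S)))
     = (- 1) ^ card I * cross_prod w x I (S - I) *
       (h (2 * int (card I) - int (card S) - 1) * (\<Prod>i\<in>I. pair_factor w (x i) (x a)) -
        h (2 * int (card I) - int (card S) + 1) * (\<Prod>j\<in>S - I. pair_factor w (x a) (x j)))"
    if "I \<in> Pow S" for I
  proof -
    have fin: "finite I" "a \<notin> I" using that assms finite_subset by auto
    have e1: "insert a S - I = insert a (S - I)" using fin by auto
    have e2: "insert a S - insert a I = S - I" using assms by auto
    have k1: "2 * int (card I) - int (card (insert a S)) = 2 * int (card I) - int (card S) - 1"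
      using assms by simp
    have k2: "2 * int (card (insert a I)) - int (card (insert a S)) = 2 * int (card I) - int (card S) + 1"
      using assms fin by simp
    have c: "card (insert a I) = Suc (card I)" using fin by simp
    show ?thesis unfolding e1 e2 k1 k2 unfolding c
      using fin assms by (simp add: cross_prod_insert_left cross_prod_insert_right algebra_simps)
  qed
  then show ?thesis
    unfolding subset_sum_def sum_Pow_insert[OF assms(2,1)] by (intro sum.cong) auto
qed

lemma subset_sum_scale:
  "subset_sum w x S (\<lambda>k. c * h k) = c * subset_sum w x S h"
  by (simp add: subset_sum_def sum_distrib_left mult_ac)

section \<open>Clearing denominators in one variable\<close>

text \<open>In the variable u, the quadratics over \<open>I\<close> are the numerators of
  \<open>pair_factor w u (x i)\<close>; those over \<open>J\<close> complete the common
  denominator.\<close>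

definition part_numer :: "complex \<Rightarrow> ('i \<Rightarrow> complex) \<Rightarrow> 'i set \<Rightarrow> 'i set \<Rightarrow> complex poly" where
  "part_numer w x I J = (\<Prod>i\<in>I. [: - (x i)\<^sup>2, w * x i, 1 :]) * (\<Prod>j\<in>J. [: - (x j)\<^sup>2, 0, 1 :])"

text \<open>\<open>subset_sum w x (insert a S) h\<close> times \<open>denom x S\<close>, as a polynomial in the variable \<open>x a\<close>.\<close>

definition numer :: "complex \<Rightarrow> ('i \<Rightarrow> complex) \<Rightarrow> 'i set \<Rightarrow> (int \<Rightarrow> complex) \<Rightarrow> complex poly" where
  "numer w x S h =
    (\<Sum>I\<in>Pow S. smult ((- 1) ^ card I * cross_prod w x I (S - I))
       (smult (h (2 * int (card I) - int (card S) - 1)) (part_numer (- w) x I (S - I)) -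
        smult (h (2 * int (card I) - int (card S) + 1)) (part_numer w x (S - I) I)))"

definition denom :: "('i \<Rightarrow> complex) \<Rightarrow> 'i set \<Rightarrow> complex poly" where
  "denom x S = (\<Prod>j\<in>S. [: - (x j)\<^sup>2, 0, 1 :])"

lemma poly_denom: "poly (denom x S) u = (\<Prod>j\<in>S. u\<^sup>2 - (x j)\<^sup>2)"
  by (simp add: denom_def poly_prod power2_eq_square algebra_simps)

lemma poly_part_numer:
  assumes "finite I" "finite J" "I \<inter> J = {}" "\<And>i. i \<in> I \<Longrightarrow> u\<^sup>2 \<noteq> (x i)\<^sup>2"
  shows "poly (part_numer w x I J) u = poly (denom x (I \<union> J)) u * (\<Prod>i\<in>I. pair_factor w u (x i))"
proof -
  have "(\<Prod>i\<in>I. u\<^sup>2 + w * x i * u - (x i)\<^sup>2) = (\<Prod>i\<in>I. (u\<^sup>2 - (x i)\<^sup>2) * pair_factor w u (x i))"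
    using assms(4) by (intro prod.cong) (auto simp: pair_factor_def field_simps)
  moreover have "poly (part_numer w x I J) u = (\<Prod>i\<in>I. u\<^sup>2 + w * x i * u - (x i)\<^sup>2) * (\<Prod>j\<in>J. u\<^sup>2 - (x j)\<^sup>2)"
    by (simp add: part_numer_def poly_prod power2_eq_square algebra_simps)
  ultimately show ?thesis using assms(1-3)
    by (simp add: poly_denom prod.union_disjoint prod.distrib)
qed

text \<open>Exchanging the arguments of a pair factor amounts to replacing \<open>w\<close> by
  \<open>- w\<close>, so the same polynomials serve both orders.\<close>

lemma poly_part_numer_uminus:
  assumes "finite I" "finite J" "I \<inter> J = {}" "\<And>i. i \<in> I \<Longrightarrow> u\<^sup>2 \<noteq> (x i)\<^sup>2"
  shows "poly (part_numer (- w) x I J) u = poly (denom x (I \<union> J)) u * (\<Prod>i\<in>I. pair_factor w (x i) u)"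
proof -
  have "pair_factor (- w) u (x i) = pair_factor w (x i) u" for i
    by (metis pair_factor_def pair_factor_minus(1) mult.commute mult_minus_left mult_minus_right power2_minus)
  then show ?thesis using poly_part_numer[OF assms, where w = "- w"] by simp
qed

lemma poly_part_numer_subset:
  assumes "finite S" "I \<subseteq> S" "\<And>i. i \<in> S \<Longrightarrow> u\<^sup>2 \<noteq> (x i)\<^sup>2"
  shows "poly (part_numer (- w) x I (S - I)) u = poly (denom x S) u * (\<Prod>i\<in>I. pair_factor w (x i) u)"
    and "poly (part_numer w x (S - I) I) u = poly (denom x S) u * (\<Prod>j\<in>S - I. pair_factor w u (x j))"
proof -
  have f: "finite I" "finite (S - I)" "I \<inter> (S - I) = {}" "(S - I) \<inter> I = {}"
      "I \<union> (S - I) = S" "(S - I) \<union> I = S"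
    using assms finite_subset by auto
  show "poly (part_numer (- w) x I (S - I)) u = poly (denom x S) u * (\<Prod>i\<in>I. pair_factor w (x i) u)"
    using poly_part_numer_uminus[OF f(1,2,3), of u x w] assms(2,3) unfolding f(5) by blast
  show "poly (part_numer w x (S - I) I) u = poly (denom x S) u * (\<Prod>j\<in>S - I. pair_factor w u (x j))"
    using poly_part_numer[OF f(2,1,4), of u x w] assms(2,3) unfolding f(6) by blast
qed

lemma poly_numer:
  assumes "finite S" "a \<notin> S" "\<And>i. i \<in> S \<Longrightarrow> (x a)\<^sup>2 \<noteq> (x i)\<^sup>2"
  shows "poly (numer w x S h) (x a) = poly (denom x S) (x a) * subset_sum w x (insert a S) h"
  unfolding subset_sum_insert[OF assms(1,2)] numer_def poly_sum sum_distrib_left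
proof (rule sum.cong[OF refl], goal_cases)
  case (1 I)
  then have ab: "poly (part_numer (- w) x I (S - I)) (x a) = poly (denom x S) (x a) * (\<Prod>i\<in>I. pair_factor w (x i) (x a))"
      "poly (part_numer w x (S - I) I) (x a) = poly (denom x S) (x a) * (\<Prod>i\<in>S - I. pair_factor w (x a) (x i))"
    using poly_part_numer_subset[where x = x and I = I and w = w, OF assms(1) _ assms(3)] by auto
  show ?case unfolding poly_smult poly_diff ab by (simp add: algebra_simps)
qed

lemma monic_quadratics:
  fixes p :: "'i \<Rightarrow> complex poly"
  assumes "finite S" "\<And>i. i \<in> S \<Longrightarrow> degree (p i) = 2 \<and> lead_coeff (p i) = 1"
  shows "degree (\<Prod>i\<in>S. p i) = 2 * card S \<and> lead_coeff (\<Prod>i\<in>S. p i) = 1"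
  using assms
proof (induction S rule: finite_induct)
  case (insert a S)
  then have "p a \<noteq> 0" "prod p S \<noteq> 0" by force+
  moreover have "lead_coeff (p a * prod p S) = 1"
    unfolding lead_coeff_mult using insert.IH insert.prems by (metis insert_iff mult_1)
  moreover have "degree (p a * prod p S) = degree (p a) + degree (prod p S)"
    using calculation by (intro degree_mult_eq) auto
  ultimately show ?case
    using insert.hyps insert.IH insert.prems by (metis (no_types, lifting) card_insert_disjoint insertCI mult_Suc_right prod.insert)
qed simp

lemma quadratic_monic:
  fixes b c :: complex
  shows "degree [:c, b, 1:] = 2 \<and> lead_coeff [:c, b, 1:] = 1"
  by (simp add: numeral_2_eq_2)

lemma part_numer_monic:
  assumes "finite S" "I \<subseteq> S"
  shows "degree (part_numer w x I (S - I)) = 2 * card S" "lead_coeff (part_numer w x I (S - I)) = 1"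
proof -
  have f: "finite I" "finite (S - I)" using assms finite_subset by auto
  have a: "degree (\<Prod>i\<in>I. [: - (x i)\<^sup>2, w * x i, 1 :]) = 2 * card I \<and> lead_coeff (\<Prod>i\<in>I. [: - (x i)\<^sup>2, w * x i, 1 :]) = 1"
    by (rule monic_quadratics[OF f(1) quadratic_monic])
  have b: "degree (\<Prod>i\<in>S - I. [: - (x i)\<^sup>2, 0, 1 :]) = 2 * card (S - I) \<and> lead_coeff (\<Prod>i\<in>S - I. [: - (x i)\<^sup>2, 0, 1 :]) = 1"
    by (rule monic_quadratics[OF f(2) quadratic_monic])
  have nz: "(\<Prod>i\<in>I. [: - (x i)\<^sup>2, w * x i, 1 :]) \<noteq> 0" "(\<Prod>i\<in>S - I. [: - (x i)\<^sup>2, 0, 1 :]) \<noteq> 0"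
    using f by auto
  have c: "card S = card I + card (S - I)"
    using assms f by (metis card_Diff_subset card_mono le_add_diff_inverse)
  show "degree (part_numer w x I (S - I)) = 2 * card S"
    unfolding part_numer_def using a b c nz by (simp add: degree_mult_eq)
  show "lead_coeff (part_numer w x I (S - I)) = 1"
    unfolding part_numer_def lead_coeff_mult a[THEN conjunct2] b[THEN conjunct2] by simp
qed

lemma denom_monic:
  assumes "finite S"
  shows "degree (denom x S) = 2 * card S" "lead_coeff (denom x S) = 1"
  using part_numer_monic[of S "{}" 0 x] assms by (simp_all add: part_numer_def denom_def)

lemma part_numer_monic_compl:
  assumes "finite S" "I \<subseteq> S"
  shows "degree (part_numer w x (S - I) I) = 2 * card S" "lead_coeff (part_numer w x (S - I) I) = 1"
  using part_numer_monic[of S "S - I" w x] assms by (simp_all add: double_diff)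

lemma degree_numer:
  assumes "finite S"
  shows "degree (numer w x S h) \<le> 2 * card S"
  unfolding numer_def
proof (rule degree_sum_le, goal_cases)
  case (2 I)
  then have "degree (part_numer (- w) x I (S - I)) \<le> 2 * card S" "degree (part_numer w x (S - I) I) \<le> 2 * card S"
    using part_numer_monic(1)[OF assms] part_numer_monic_compl(1)[OF assms] by (simp_all only: Pow_iff)
  then show ?case
    by (intro order.trans[OF degree_smult_le] degree_diff_le) auto
qed (simp add: assms)

text \<open>All the polynomials \<open>part_numer\<close> occurring here are monic of degree 2 |S|,
  so only the weights remain. Analytically: pair factors with u tend to 1 as u tends to
  infinity.\<close>

lemma coeff_numer:
  assumes "finite S"
  shows "coeff (numer w x S h) (2 * card S) = subset_sum w x S (\<lambda>k. h (k - 1) - h (k + 1))"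
  unfolding numer_def subset_sum_def coeff_sum
proof (rule sum.cong[OF refl], goal_cases)
  case (1 I)
  then show ?case
    using part_numer_monic[OF assms, of I "- w" x] part_numer_monic_compl[OF assms, of I w x] by simp
qed

text \<open>The linear terms of the quadratics vanish at u = 0, so every \<open>part_numer\<close>
  reduces to \<open>denom\<close> and the sum is the one found for the top coefficient.\<close>

lemma poly_numer_0:
  assumes "finite S"
  shows "poly (numer w x S h) 0 = poly (denom x S) 0 * subset_sum w x S (\<lambda>k. h (k - 1) - h (k + 1))"
  unfolding numer_def subset_sum_def poly_sum sum_distrib_left
proof (rule sum.cong[OF refl], goal_cases)
  case (1 I)
  have e: "(\<Prod>i\<in>I. - (x i)\<^sup>2) * (\<Prod>j\<in>S - I. - (x j)\<^sup>2) = (\<Prod>j\<in>S. - (x j)\<^sup>2)"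
    using prod.subset_diff[of I S "\<lambda>j. - (x j)\<^sup>2"] assms 1 by (simp add: mult.commute)
  have a: "poly (part_numer v x I (S - I)) 0 = poly (denom x S) 0" for v
    using e by (simp add: part_numer_def poly_denom poly_prod)
  have b: "poly (part_numer v x (S - I) I) 0 = poly (denom x S) 0" for v
    using e by (simp add: part_numer_def poly_denom poly_prod mult.commute)
  show ?case by (simp add: a b algebra_simps)
qed

section \<open>Residues at x_r and -x_r\<close>

lemma poly_part_numer_insert:
  assumes "finite I" "finite J"
  shows "r \<notin> I \<Longrightarrow> poly (part_numer w x (insert r I) J) u = (u\<^sup>2 + w * x r * u - (x r)\<^sup>2) * poly (part_numer w x I J) u"
    and "r \<notin> J \<Longrightarrow> poly (part_numer w x I (insert r J)) u = (u\<^sup>2 - (x r)\<^sup>2) * poly (part_numer w x I J) u"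
  using assms by (simp_all add: part_numer_def poly_prod power2_eq_square algebra_simps)

text \<open>When u^2 = x_r^2, a term survives only if u and x_r lie on opposite sides of the
  splitting. Together they then contribute 0 to the index, so \<open>h\<close> is taken at the index
  belonging to \<open>S\<close> alone.\<close>

lemma poly_numer_root:
  assumes "finite S" "r \<notin> S" "u\<^sup>2 = (x r)\<^sup>2"
  shows "poly (numer w x (insert r S) h) u =
     - (w * x r * u) * (\<Sum>I\<in>Pow S. (- 1) ^ card I * cross_prod w x I (S - I) *
        h (2 * int (card I) - int (card S)) *
        ((\<Prod>i\<in>I. pair_factor w (x i) (x r)) * poly (part_numer w x (S - I) I) u
         - (\<Prod>j\<in>S - I. pair_factor w (x r) (x j)) * poly (part_numer (- w) x I (S - I)) u))"
  unfolding numer_def poly_sum sum_Pow_insert[OF assms(2,1)] sum_distrib_left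
proof (rule sum.cong[OF refl], goal_cases)
  case (1 I)
  have f: "finite I" "finite (S - I)" "r \<notin> I" "r \<notin> S - I"
    using 1 assms finite_subset by auto
  have e: "insert r S - I = insert r (S - I)" "insert r S - insert r I = S - I"
    using 1 assms(2) f(3) by auto
  have k: "2 * int (card I) - int (card (insert r S)) + 1 = 2 * int (card I) - int (card S)"
      "2 * int (card (insert r I)) - int (card (insert r S)) - 1 = 2 * int (card I) - int (card S)"
      "card (insert r I) = Suc (card I)"
    using assms f by auto
  have n: "poly (part_numer (- w) x I (insert r (S - I))) u = 0"
      "poly (part_numer w x (S - I) (insert r I)) u = 0"
      "poly (part_numer w x (insert r (S - I)) I) u = w * x r * u * poly (part_numer w x (S - I) I) u"
      "poly (part_numer (- w) x (insert r I) (S - I)) u = - (w * x r * u) * poly (part_numer (- w) x I (S - I)) u"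
    using f assms(3) by (simp_all add: poly_part_numer_insert)
  show ?case
    unfolding e unfolding k(1,2) unfolding k(3) poly_smult poly_diff poly_add unfolding n
      cross_prod_insert_left[OF f(1,3)] cross_prod_insert_right[OF f(2,4)] power_Suc
    by (simp add: algebra_simps)
qed

text \<open>At u = x_r the two surviving terms for each \<open>I\<close>, which differ by exchanging
  u and x_r, cancel.\<close>

lemma poly_numer_at:
  assumes "finite S" "r \<notin> S" "\<And>i. i \<in> S \<Longrightarrow> (x r)\<^sup>2 \<noteq> (x i)\<^sup>2"
  shows "poly (numer w x (insert r S) h) (x r) = 0"
proof -
  have "(\<Prod>i\<in>I. pair_factor w (x i) (x r)) * poly (part_numer w x (S - I) I) (x r)
         = (\<Prod>j\<in>S - I. pair_factor w (x r) (x j)) * poly (part_numer (- w) x I (S - I)) (x r)" if "I \<in> Pow S" for I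
    using that poly_part_numer_subset[where x = x and I = I and w = w, OF assms(1) _ assms(3)] by (simp add: Pow_def)
  then show ?thesis
    by (subst poly_numer_root) (use assms in auto)
qed

text \<open>At u = -x_r the reflection rule turns the products over \<open>I\<close> and over
  \<open>S - I\<close> into one product over all of \<open>S\<close>. It no longer depends on
  \<open>I\<close> and can be taken out of the sum.\<close>

lemma poly_numer_at_minus:
  assumes "finite S" "r \<notin> S" "\<And>i. i \<in> S \<Longrightarrow> (x r)\<^sup>2 \<noteq> (x i)\<^sup>2"
  shows "poly (numer w x (insert r S) h) (- x r) =
     w * (x r)\<^sup>2 * poly (denom x S) (x r) *
     ((\<Prod>i\<in>S. pair_factor w (x i) (x r)) - (\<Prod>i\<in>S. pair_factor w (x r) (x i))) * subset_sum w x S h"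
proof -
  have "(\<Prod>i\<in>I. pair_factor w (x i) (x r)) * poly (part_numer w x (S - I) I) (- x r)
         - (\<Prod>j\<in>S - I. pair_factor w (x r) (x j)) * poly (part_numer (- w) x I (S - I)) (- x r)
       = poly (denom x S) (x r) * ((\<Prod>i\<in>S. pair_factor w (x i) (x r)) - (\<Prod>i\<in>S. pair_factor w (x r) (x i)))"
    if "I \<in> Pow S" for I
  proof -
    have f: "I \<subseteq> S" "\<And>i. i \<in> S \<Longrightarrow> (- x r)\<^sup>2 \<noteq> (x i)\<^sup>2"
      using that assms(3) by auto
    have n: "poly (part_numer (- w) x I (S - I)) (- x r) = poly (denom x S) (- x r) * (\<Prod>i\<in>I. pair_factor w (x i) (- x r))"
        "poly (part_numer w x (S - I) I) (- x r) = poly (denom x S) (- x r) * (\<Prod>j\<in>S - I. pair_factor w (- x r) (x j))"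
      using poly_part_numer_subset[of S I "- x r" x w] assms(1) f by auto
    have d: "poly (denom x S) (- x r) = poly (denom x S) (x r)" by (simp add: poly_denom)
    have sp: "prod g S = prod g I * prod g (S - I)" for g :: "_ \<Rightarrow> complex"
      using prod.subset_diff[OF f(1) assms(1), of g] by (simp add: mult.commute)
    show ?thesis
      unfolding n unfolding pair_factor_minus d
        sp[of "\<lambda>i. pair_factor w (x i) (x r)"] sp[of "\<lambda>i. pair_factor w (x r) (x i)"]
      by (simp add: algebra_simps)
  qed
  note * = this
  have "poly (numer w x (insert r S) h) (- x r) = - (w * x r * - x r) *
     (\<Sum>I\<in>Pow S. (- 1) ^ card I * cross_prod w x I (S - I) * h (2 * int (card I) - int (card S)) *
       (poly (denom x S) (x r) * ((\<Prod>i\<in>S. pair_factor w (x i) (x r)) - (\<Prod>i\<in>S. pair_factor w (x r) (x i)))))"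
    by (subst poly_numer_root[OF assms(1,2)]) (simp_all only: power2_minus mult.assoc * cong: sum.cong)
  also have "\<dots> = w * (x r)\<^sup>2 * poly (denom x S) (x r) *
     ((\<Prod>i\<in>S. pair_factor w (x i) (x r)) - (\<Prod>i\<in>S. pair_factor w (x r) (x i))) * subset_sum w x S h"
    unfolding subset_sum_def sum_distrib_right[symmetric] by (simp add: power2_eq_square algebra_simps)
  finally show ?thesis .
qed

section \<open>Root counting and the sum with weight 1\<close>

lemma poly_eq_0_if_roots:
  fixes p :: "complex poly"
  assumes "finite A" "\<And>a. a \<in> A \<Longrightarrow> poly p a = 0" "degree p \<le> card A" "coeff p (card A) = 0"
  shows "p = 0"
proof (rule ccontr)
  assume "p \<noteq> 0"
  have "card A \<le> card {x. poly p x = 0}"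
    using assms(2) poly_roots_finite[OF \<open>p \<noteq> 0\<close>] by (intro card_mono) auto
  also have "\<dots> \<le> degree p"
    using card_poly_roots_bound[OF \<open>p \<noteq> 0\<close>] .
  finally have "card A = degree p" using assms(3) by simp
  then show False using assms(4) \<open>p \<noteq> 0\<close> by simp
qed

definition roots_of :: "('i \<Rightarrow> complex) \<Rightarrow> 'i set \<Rightarrow> complex set" where
  "roots_of x S = x ` S \<union> (\<lambda>i. - x i) ` S"

lemma card_roots_of:
  assumes "finite S" "regular x S"
  shows "finite (roots_of x S)" "card (roots_of x S) = 2 * card S" "0 \<notin> roots_of x S"
proof -
  have inj: "inj_on x S" "inj_on (\<lambda>i. - x i) S"
    using assms(2) unfolding inj_on_def regular_def by (metis neg_equal_iff_equal)+
  have "x ` S \<inter> (\<lambda>i. - x i) ` S = {}"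
  proof (rule ccontr)
    assume "x ` S \<inter> (\<lambda>i. - x i) ` S \<noteq> {}"
    then obtain i j where ij: "i \<in> S" "j \<in> S" "x i = - x j" by auto
    then have "(x i)\<^sup>2 = (x j)\<^sup>2" by simp
    then have "i = j" using assms(2) ij(1,2) unfolding regular_def by (auto dest: inj_onD)
    then have "x i = 0" using ij(3) by simp
    then show False using ij(1) assms(2) unfolding regular_def by blast
  qed
  then show "card (roots_of x S) = 2 * card S"
    unfolding roots_of_def using assms(1) inj by (simp add: card_Un_disjoint card_image)
  have "\<And>i. i \<in> S \<Longrightarrow> x i \<noteq> 0"
    using assms(2) unfolding regular_def by blast
  then show "finite (roots_of x S)" "0 \<notin> roots_of x S"
    using assms(1) unfolding roots_of_def by force+
qed

lemma regular_subset: "regular x S \<Longrightarrow> T \<subseteq> S \<Longrightarrow> regular x T"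
  unfolding regular_def by (metis inj_on_subset subsetD)

lemma regular_cong: "(\<And>i. i \<in> S \<Longrightarrow> x i = y i) \<Longrightarrow> regular x S \<longleftrightarrow> regular y S"
  unfolding regular_def by (simp cong: inj_on_cong)

lemma regular_insert:
  assumes "a \<notin> S"
  shows "regular x (insert a S) \<longleftrightarrow>
    regular x S \<and> x a \<noteq> 0 \<and> (\<forall>i\<in>S. (x a)\<^sup>2 \<noteq> (x i)\<^sup>2)"
  using assms unfolding regular_def by (auto simp: inj_on_insert image_iff simp del: power2_eq_iff)

lemma poly_denom_nonzero:
  assumes "finite S" "a \<notin> S" "regular x (insert a S)"
  shows "poly (denom x S) (x a) \<noteq> 0"
proof -
  have "(x a)\<^sup>2 \<noteq> (x i)\<^sup>2" if "i \<in> S" for i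
    using that assms(3) regular_insert[OF assms(2)] by blast
  then show ?thesis
    unfolding poly_denom prod_zero_iff[OF assms(1)] by (metis right_minus_eq)
qed

lemma poly_numer_regular:
  assumes "finite S" "regular x S" "r \<in> S"
  shows "poly (numer w x S h) (x r) = 0"
    "poly (numer w x S h) (- x r) =
       w * (x r)\<^sup>2 * poly (denom x (S - {r})) (x r) *
       ((\<Prod>i\<in>S - {r}. pair_factor w (x i) (x r)) - (\<Prod>i\<in>S - {r}. pair_factor w (x r) (x i))) * subset_sum w x (S - {r}) h"
proof -
  have a: "finite (S - {r})" "r \<notin> S - {r}" "\<And>i. i \<in> S - {r} \<Longrightarrow> (x r)\<^sup>2 \<noteq> (x i)\<^sup>2" "insert r (S - {r}) = S"
    using assms regular_insert[of r "S - {r}" x] by (simp_all add: insert_absorb del: power2_eq_iff)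
  show "poly (numer w x S h) (x r) = 0"
    using poly_numer_at[of "S - {r}" r x w h] a by auto
  show "poly (numer w x S h) (- x r) =
       w * (x r)\<^sup>2 * poly (denom x (S - {r})) (x r) *
       ((\<Prod>i\<in>S - {r}. pair_factor w (x i) (x r)) - (\<Prod>i\<in>S - {r}. pair_factor w (x r) (x i))) * subset_sum w x (S - {r}) h"
    using poly_numer_at_minus[of "S - {r}" r x w h] a by auto
qed

lemma poly_numer_eq_subset_sum:
  assumes "finite S" "a \<notin> S" "regular x (insert a S)"
  shows "poly (numer w x S h) (x a) = poly (denom x S) (x a) * subset_sum w x (insert a S) h"
  using assms by (intro poly_numer) (simp_all add: regular_insert del: power2_eq_iff)

lemma subset_sum_empty: "subset_sum w x {} h = h 0"
  by (simp add: subset_sum_def cross_prod_def)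

lemma subset_sum_singleton: "subset_sum w x {a} h = h (- 1) - h 1"
  using subset_sum_insert[of "{}" a w x h] by (simp add: cross_prod_def)

text \<open>Single out one variable. The numerator has degree at most 2 |S|, its top coefficient
  vanishes because the weight is constant, and the points x_r and -x_r are 2 |S| roots.\<close>

lemma subset_sum_1:
  assumes "finite T" "T \<noteq> {}" "regular x T"
  shows "subset_sum w x T (\<lambda>_. 1) = 0"
  using assms
proof (induction "card T" arbitrary: T rule: less_induct)
  case less
  then obtain a where a: "a \<in> T" by auto
  define S where "S = T - {a}"
  have S: "finite S" "a \<notin> S" "T = insert a S" "regular x S"
    using less.prems a regular_subset[of x T S] by (auto simp: S_def)
  have "poly (numer w x S (\<lambda>_. 1)) z = 0" if z: "z \<in> roots_of x S" for z
  proof -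
    obtain r where r: "r \<in> S" "z = x r \<or> z = - x r"
      using z unfolding roots_of_def by auto
    have c: "card (S - {r}) < card T"
      using S(1-3) r(1) card_Diff1_less[of S r] by simp
    have "subset_sum w x (S - {r}) (\<lambda>_. 1) = 0" if "S - {r} \<noteq> {}"
      using less.hyps[OF c _ that] S(1) regular_subset[OF S(4), of "S - {r}"] by simp
    then have "poly (numer w x S (\<lambda>_. 1)) (- x r) = 0"
      unfolding poly_numer_regular(2)[OF S(1,4) r(1)]
      by (metis diff_self mult_eq_0_iff prod.empty)
    then show ?thesis using poly_numer_regular(1)[OF S(1,4) r(1)] r(2) by auto
  qed
  then have "numer w x S (\<lambda>_. 1) = 0"
    using card_roots_of[OF S(1,4)] degree_numer[OF S(1)] coeff_numer[OF S(1)]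
    by (intro poly_eq_0_if_roots[of "roots_of x S"]) (auto simp: subset_sum_def)
  then show ?case
    using poly_numer_eq_subset_sum[OF S(1,2), of x w "\<lambda>_. 1"] poly_denom_nonzero[OF S(1,2), of x] less.prems S(3) by auto
qed

text \<open>At q = exp (i pi \<nu>) and x_i = exp \<theta>_i, its vanishing is the field equation
  stripped of common factors.\<close>

definition defect :: "complex \<Rightarrow> ('i \<Rightarrow> complex) \<Rightarrow> 'i set \<Rightarrow> complex" where
  "defect q x S = (let w = q - inverse q in
     subset_sum w x S (\<lambda>k. q powi k) - subset_sum w x S (\<lambda>k. q powi (- k))
     - w * (\<Sum>i\<in>S. x i) * (\<Sum>i\<in>S. inverse (x i)) * subset_sum w x S of_int)"

lemma numer_upd: "a \<notin> S \<Longrightarrow> numer w (x(a := u)) S h = numer w x S h"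
  unfolding numer_def part_numer_def
  by (intro sum.cong refl arg_cong2[of _ _ _ _ smult] arg_cong2[of _ _ _ _ "(-)"] arg_cong2[of _ _ _ _ "(*)"] prod.cong cross_prod_upd) auto

lemma denom_upd: "a \<notin> S \<Longrightarrow> denom (x(a := u)) S = denom x S"
  unfolding denom_def by (intro prod.cong) auto

section \<open>The functional identity\<close>

text \<open>Times u and the common denominator, the defect is a polynomial \<open>Q\<close> of
  degree at most 2n + 1 in u = x_a. It vanishes at the 2n + 1 distinct roots of \<open>D\<close>, so
  it is a constant multiple of \<open>D\<close>. The hypothesis on \<open>S - {r}\<close> supplies
  the roots -x_r.\<close>

lemma defect_constant:
  assumes "finite S" "S \<noteq> {}" "a \<notin> S" "regular x S" "\<And>r. r \<in> S \<Longrightarrow> defect q x (S - {r}) = 0"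
  obtains c where "\<And>u. regular (x(a := u)) (insert a S) \<Longrightarrow> defect q (x(a := u)) (insert a S) = c"
proof -
  define w where "w = q - inverse q"
  define n where "n = card S"
  have n: "n \<ge> 1" using assms(1,2) unfolding n_def by (simp add: Suc_leI card_gt_0_iff)
  define P where "P = (\<Sum>i\<in>S. x i)"
  define M where "M = (\<Sum>i\<in>S. inverse (x i))"
  define N where "N = numer w x S"
  \<comment> \<open>The extra factor u clears the pole of the sum of inverses: u (u + P) (1/u + M) =
    (u + P) (1 + M u).\<close>
  define Q where "Q = pCons 0 (N (\<lambda>k. q powi k) - N (\<lambda>k. q powi (- k)))
     - smult w ([:P, 1:] * [:1, M:] * N of_int)"
  define D where "D = pCons 0 (denom x S)"
  define c where "c = coeff Q (2 * n + 1)"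
  define R where "R = insert 0 (roots_of x S)"
  have R: "finite R" "card R = 2 * n + 1"
    using card_roots_of[OF assms(1,4)] by (simp_all add: R_def n_def)
  \<comment> \<open>For the weight k the difference of shifted weights is the constant -2. Hence the
    sum with weight 1 yields both the lower degree of \<open>N of_int\<close> and the root of
    \<open>Q\<close> at 0.\<close>
  have W0: "subset_sum w x S (\<lambda>k. of_int (k - 1) - of_int (k + 1)) = 0"
    using subset_sum_scale[of w x S "- 2" "\<lambda>_. 1"] subset_sum_1[OF assms(1,2,4)] by simp
  have degN: "degree (N of_int) \<le> 2 * n - 1"
    using degree_numer[OF assms(1), of w x of_int] coeff_numer[OF assms(1), of w x of_int] W0
    unfolding N_def n_def using leading_coeff_0_iff[of "numer w x S of_int"]
    by (cases "degree (numer w x S of_int) = 2 * card S") auto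
  have degQ: "degree Q \<le> 2 * n + 1"
    unfolding Q_def
  proof (rule degree_diff_le)
    show "degree (pCons 0 (N (\<lambda>k. q powi k) - N (\<lambda>k. q powi (- k)))) \<le> 2 * n + 1"
      using degree_diff_le[OF degree_numer[OF assms(1)] degree_numer[OF assms(1)], of w x _ w x]
      unfolding N_def n_def by (auto intro!: order.trans[OF degree_pCons_le])
    have "degree ([:P, 1:] * [:1, M:] * N of_int) \<le> 1 + 1 + (2 * n - 1)"
      using degN by (intro order.trans[OF degree_mult_le] add_mono) (auto intro: order.trans[OF degree_pCons_le])
    then show "degree (smult w ([:P, 1:] * [:1, M:] * N of_int)) \<le> 2 * n + 1"
      using n by (auto intro: order.trans[OF degree_smult_le])
  qed
  have degD: "degree D = 2 * n + 1" "coeff D (2 * n + 1) = 1"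
    using denom_monic[OF assms(1), of x] unfolding D_def n_def by (auto simp: coeff_pCons)
  have "poly Q z = 0" if z: "z \<in> R" for z
  proof (cases "z = 0")
    case True
    then show ?thesis
      using poly_numer_0[OF assms(1), of w x of_int] W0 by (simp add: Q_def N_def)
  next
    case False
    then obtain r where r: "r \<in> S" "z = x r \<or> z = - x r"
      using z unfolding R_def roots_of_def by auto
    have xr: "x r \<noteq> 0" using r(1) assms(4) unfolding regular_def by auto
    have 1: "poly Q (x r) = 0"
      by (simp add: Q_def N_def poly_numer_regular(1)[OF assms(1,4) r(1)])
    obtain E where E: "\<And>h. poly (N h) (- x r) = E * subset_sum w x (S - {r}) h"
      using poly_numer_regular(2)[OF assms(1,4) r(1)] unfolding N_def by blast
    \<comment> \<open>At u = -x_r the new variable cancels the term of index r in both sums, which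
      leaves the sums that occur in the defect of \<open>S - {r}\<close>.\<close>
    have PM: "P - x r = (\<Sum>i\<in>S - {r}. x i)" "M - inverse (x r) = (\<Sum>i\<in>S - {r}. inverse (x i))"
      unfolding P_def M_def using assms(1) r(1) by (simp_all add: sum_diff1)
    have "poly Q (- x r) = - (x r * E * defect q x (S - {r}))"
      unfolding Q_def defect_def Let_def w_def[symmetric] PM[symmetric]
      using xr by (simp add: E field_simps)
    then show ?thesis using 1 r assms(5) by auto
  qed
  \<comment> \<open>\<open>D\<close> has top coefficient 1, so subtracting \<open>c\<close> times
    \<open>D\<close> removes the coefficient at 2n + 1 while keeping all 2n + 1 roots.\<close>
  then have "Q - smult c D = 0"
    using R degQ degD c_def
    by (intro poly_eq_0_if_roots[of R])
       (auto simp: D_def poly_denom R_def roots_of_def assms(1) intro!: degree_diff_le order.trans[OF degree_smult_le])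
  then have Q: "Q = smult c D" by simp
  have "defect q (x(a := u)) (insert a S) = c" if reg: "regular (x(a := u)) (insert a S)" for u
  proof -
    have u: "u \<noteq> 0" using reg unfolding regular_def by auto
    have nz: "poly (denom x S) u \<noteq> 0"
      using poly_denom_nonzero[OF assms(1,3) reg] assms(3) by (simp add: denom_upd)
    have NW: "poly (N h) u = poly (denom x S) u * subset_sum w (x(a := u)) (insert a S) h" for h
      using poly_numer_eq_subset_sum[OF assms(1,3) reg, of w h] assms(3) by (simp add: denom_upd numer_upd N_def)
    have PM: "(\<Sum>i\<in>insert a S. (x(a := u)) i) = u + P" "(\<Sum>i\<in>insert a S. inverse ((x(a := u)) i)) = inverse u + M"
      unfolding P_def M_def using assms(1,3) by (auto intro!: sum.cong)
    have "poly Q u = u * poly (denom x S) u * defect q (x(a := u)) (insert a S)"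
      unfolding defect_def Let_def PM w_def[symmetric] unfolding Q_def
      using u by (simp add: NW field_simps)
    moreover have "poly Q u = u * poly (denom x S) u * c" unfolding Q D_def by simp
    ultimately show ?thesis using u nz by simp
  qed
  then show ?thesis using that by blast
qed

section \<open>Two variables tending to infinity\<close>

lemma subset_sum_insert2:
  assumes "finite S" "a \<notin> S" "b \<notin> S" "a \<noteq> b"
  shows "subset_sum w x (insert a (insert b S)) h =
    (\<Sum>I\<in>Pow S. (- 1) ^ card I * cross_prod w x I (S - I) *
       (h (2 * int (card I) - int (card S) - 2) * ((\<Prod>i\<in>I. pair_factor w (x i) (x a)) * (\<Prod>i\<in>I. pair_factor w (x i) (x b))) +
        h (2 * int (card I) - int (card S) + 2) * ((\<Prod>j\<in>S - I. pair_factor w (x a) (x j)) * (\<Prod>j\<in>S - I. pair_factor w (x b) (x j))) -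
        h (2 * int (card I) - int (card S)) *
          (pair_factor w (x a) (x b) * ((\<Prod>j\<in>S - I. pair_factor w (x a) (x j)) * (\<Prod>i\<in>I. pair_factor w (x i) (x b))) +
           pair_factor w (x b) (x a) * ((\<Prod>j\<in>S - I. pair_factor w (x b) (x j)) * (\<Prod>i\<in>I. pair_factor w (x i) (x a))))))"
proof -
  have fin: "finite (insert b S)" "a \<notin> insert b S" using assms by auto
  show ?thesis
    unfolding subset_sum_insert[OF fin] unfolding sum_Pow_insert[OF assms(3,1)]
  proof (rule sum.cong[OF refl], goal_cases)
    case (1 I)
    have f: "finite I" "finite (S - I)" "b \<notin> I" "b \<notin> S - I"
      using 1 assms finite_subset by auto
    have e: "insert b S - I = insert b (S - I)" "insert b S - insert b I = S - I"
      using 1 assms(3) f(3) by auto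
    have k: "2 * int (card I) - int (card (insert b S)) - 1 = 2 * int (card I) - int (card S) - 2"
      "2 * int (card I) - int (card (insert b S)) + 1 = 2 * int (card I) - int (card S)"
      "2 * int (card (insert b I)) - int (card (insert b S)) - 1 = 2 * int (card I) - int (card S)"
      "2 * int (card (insert b I)) - int (card (insert b S)) + 1 = 2 * int (card I) - int (card S) + 2"
      "card (insert b I) = Suc (card I)"
      using assms f by auto
    show ?case
      unfolding e unfolding k(1-4) unfolding k(5)
        cross_prod_insert_left[OF f(1,3)] cross_prod_insert_right[OF f(2,4)] power_Suc
        prod.insert[OF f(1,3)] prod.insert[OF f(2,4)]
      by (simp add: algebra_simps)
  qed
qed

text \<open>First-order expansion: coefficients of 1/N add up in a product. This precision is needed
  because the mutual factor of the two large variables grows like N.\<close>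

lemma tendsto_scaled_prod:
  fixes g :: "nat \<Rightarrow> 'i \<Rightarrow> complex"
  assumes "finite A" "\<And>i. i \<in> A \<Longrightarrow> (\<lambda>N. of_nat N * (g N i - 1)) \<longlonglongrightarrow> \<alpha> i"
  shows "(\<lambda>N. of_nat N * ((\<Prod>i\<in>A. g N i) - 1)) \<longlonglongrightarrow> (\<Sum>i\<in>A. \<alpha> i)"
  using assms
proof (induction A rule: finite_induct)
  case (insert a A)
  have 1: "(\<lambda>N. of_nat N * ((\<Prod>i\<in>A. g N i) - 1)) \<longlonglongrightarrow> (\<Sum>i\<in>A. \<alpha> i)"
    and 2: "(\<lambda>N. of_nat N * (g N a - 1)) \<longlonglongrightarrow> \<alpha> a"
    using insert by auto
  have "(\<lambda>N. of_nat N * ((\<Prod>i\<in>A. g N i) - 1) + of_nat N * (g N a - 1)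
      + of_nat N * (g N a - 1) * (of_nat N * ((\<Prod>i\<in>A. g N i) - 1)) * (1 / of_nat N))
      \<longlonglongrightarrow> (\<Sum>i\<in>A. \<alpha> i) + \<alpha> a + \<alpha> a * (\<Sum>i\<in>A. \<alpha> i) * 0"
    by (intro tendsto_intros 1 2 lim_1_over_n)
  moreover have "\<forall>\<^sub>F N in sequentially.
      of_nat N * ((\<Prod>i\<in>A. g N i) - 1) + of_nat N * (g N a - 1)
      + of_nat N * (g N a - 1) * (of_nat N * ((\<Prod>i\<in>A. g N i) - 1)) * (1 / of_nat N)
      = of_nat N * ((\<Prod>i\<in>insert a A. g N i) - 1)"
    using eventually_gt_at_top[of 0]
    by eventually_elim (use insert in \<open>simp add: field_simps\<close>)
  ultimately show ?case
    using insert by (simp add: tendsto_cong add.commute)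
qed simp

lemma tendsto_1_if_scaled:
  fixes g :: "nat \<Rightarrow> complex"
  assumes "(\<lambda>N. of_nat N * (g N - 1)) \<longlonglongrightarrow> \<alpha>"
  shows "g \<longlonglongrightarrow> 1"
proof -
  have "(\<lambda>N. of_nat N * (g N - 1) * (1 / of_nat N) + 1) \<longlonglongrightarrow> \<alpha> * 0 + 1"
    by (intro tendsto_intros assms lim_1_over_n)
  moreover have "\<forall>\<^sub>F N in sequentially. of_nat N * (g N - 1) * (1 / of_nat N) + 1 = g N"
    using eventually_gt_at_top[of 0] by eventually_elim simp
  ultimately show ?thesis by (simp add: tendsto_cong)
qed

text \<open>For large u the fraction in the pair factor behaves like w y / u. The constant
  \<open>c\<close> will be -1 for u = 1 - N and 1 for u = N.\<close>

lemma tendsto_scaled_pair_factor: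
  fixes u :: "nat \<Rightarrow> complex"
  assumes "(\<lambda>N. of_nat N / u N) \<longlonglongrightarrow> c" "\<forall>\<^sub>F N in sequentially. u N \<noteq> 0"
    "(\<lambda>N. 1 / u N) \<longlonglongrightarrow> 0"
  shows "(\<lambda>N. of_nat N * (pair_factor w (u N) y - 1)) \<longlonglongrightarrow> c * w * y"
    and "(\<lambda>N. of_nat N * (pair_factor w y (u N) - 1)) \<longlonglongrightarrow> - (c * w * y)"
proof -
  have *: "(\<lambda>N. of_nat N * (pair_factor w (u N) y - 1)) \<longlonglongrightarrow> c * w * y" for y
  proof -
    have "(\<lambda>N. of_nat N / u N * w * y / (1 - (y * (1 / u N))\<^sup>2)) \<longlonglongrightarrow> c * w * y / (1 - (y * 0)\<^sup>2)"
      by (intro tendsto_intros assms) auto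
    moreover have "\<forall>\<^sub>F N in sequentially. of_nat N / u N * w * y / (1 - (y * (1 / u N))\<^sup>2)
        = of_nat N * (pair_factor w (u N) y - 1)"
      using assms(2)
    proof eventually_elim
      case (elim N)
      have "(u N)\<^sup>2 - y\<^sup>2 = (u N)\<^sup>2 * (1 - (y * (1 / u N))\<^sup>2)"
        using elim by (simp add: field_simps)
      then show ?case using elim by (simp add: pair_factor_def power2_eq_square)
    qed
    ultimately show ?thesis by (simp add: tendsto_cong)
  qed
  show "(\<lambda>N. of_nat N * (pair_factor w (u N) y - 1)) \<longlonglongrightarrow> c * w * y" by (rule *)
  \<comment> \<open>The reversed order is the first claim at -y.\<close>
  have "pair_factor w y (u N) = pair_factor w (u N) (- y)" for N
    by (metis add.inverse_inverse pair_factor_minus(1,2))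
  then show "(\<lambda>N. of_nat N * (pair_factor w y (u N) - 1)) \<longlonglongrightarrow> - (c * w * y)"
    using *[of "- y"] by simp
qed

lemma lim_inverse_one_minus_nat: "(\<lambda>N. inverse (1 - of_nat N)) \<longlonglongrightarrow> (0::complex)"
proof -
  have inv: "(\<lambda>N. inverse (of_nat N)) \<longlonglongrightarrow> (0::complex)"
    using lim_1_over_n by (simp add: inverse_eq_divide)
  have "(\<lambda>N. inverse (of_nat N) * inverse (inverse (of_nat N) - 1)) \<longlonglongrightarrow> 0 * inverse (0 - 1 :: complex)"
    by (intro tendsto_intros inv) simp
  moreover have "\<forall>\<^sub>F N in sequentially.
      inverse (of_nat N) * inverse (inverse (of_nat N) - 1) = inverse (1 - of_nat N :: complex)"
    using eventually_gt_at_top[of 0]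
  proof eventually_elim
    case (elim N)
    then have "of_nat N * (inverse (of_nat N) - 1) = (1 - of_nat N :: complex)" by (simp add: algebra_simps)
    then show ?case by (metis inverse_mult_distrib)
  qed
  ultimately show ?thesis by (simp add: tendsto_cong)
qed

text \<open>If \<open>a\<close> and \<open>b\<close> are both outside \<open>I\<close> or both
  inside, the weight is shifted by -2 or 2. If they are separated, their mutual factor is large.
  Keeping x_a + x_b = 1 avoids its pole at x_a = -x_b and makes it grow like w N / 2.\<close>

lemma subset_sum_limit:
  fixes x :: "'i \<Rightarrow> complex"
  assumes "finite S" "a \<notin> S" "b \<notin> S" "a \<noteq> b"
  shows "(\<lambda>N. subset_sum w (x(a := 1 - of_nat N, b := of_nat N)) (insert a (insert b S)) h) \<longlonglongrightarrow>
    subset_sum w x S (\<lambda>k. h (k - 2) + h (k + 2) - (2 - w\<^sup>2 * (\<Sum>i\<in>S. x i)) * h k)"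
proof -
  define u v :: "nat \<Rightarrow> complex" where "u N = 1 - of_nat N" and "v N = of_nat N" for N
  define s where "s = (\<Sum>i\<in>S. x i)"
  have ev: "\<forall>\<^sub>F N in sequentially. u N \<noteq> 0" "\<forall>\<^sub>F N in sequentially. v N \<noteq> 0"
    using eventually_gt_at_top[of 1] by (eventually_elim, simp add: u_def v_def)+
  have v0: "(\<lambda>N. 1 / v N) \<longlonglongrightarrow> 0"
    unfolding v_def by (rule lim_1_over_n)
  have u0: "(\<lambda>N. 1 / u N) \<longlonglongrightarrow> 0"
    using lim_inverse_one_minus_nat by (simp add: u_def inverse_eq_divide)
  have "(\<lambda>N. 1 / u N - 1) \<longlonglongrightarrow> 0 - 1" by (intro tendsto_intros u0)
  moreover have "\<forall>\<^sub>F N in sequentially. 1 / u N - 1 = of_nat N / u N"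
    using ev(1) by eventually_elim (simp add: u_def field_simps)
  ultimately have uc: "(\<lambda>N. of_nat N / u N) \<longlonglongrightarrow> - 1" by (simp add: tendsto_cong)
  have "\<forall>\<^sub>F N in sequentially. of_nat N / v N = 1"
    using ev(2) by eventually_elim (simp add: v_def)
  then have vc: "(\<lambda>N. of_nat N / v N) \<longlonglongrightarrow> 1" by (rule tendsto_eventually)
  note lu = tendsto_scaled_pair_factor[OF uc ev(1) u0, of w] and lv = tendsto_scaled_pair_factor[OF vc ev(2) v0, of w]
  have g: "(\<lambda>N. (pair_factor w (u N) (v N) - 1) * (1 / of_nat N)) \<longlonglongrightarrow> w / 2"
  proof -
    have "(\<lambda>N. w * ((1 / of_nat N - 1) / (1 / of_nat N - 2))) \<longlonglongrightarrow> w * ((0 - 1) / (0 - 2))"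
      by (intro tendsto_intros lim_1_over_n) simp
    moreover have "\<forall>\<^sub>F N in sequentially. w * ((1 / of_nat N - 1) / (1 / of_nat N - 2))
        = (pair_factor w (u N) (v N) - 1) * (1 / of_nat N)"
      using ev(2)
    proof eventually_elim
      case (elim N)
      have "(u N)\<^sup>2 - (v N)\<^sup>2 = v N * (1 / v N - 2)"
        using elim by (simp add: u_def v_def power2_eq_square field_simps)
      moreover have "u N = v N * (1 / v N - 1)"
        using elim by (simp add: u_def v_def field_simps)
      ultimately show ?case
        using elim unfolding pair_factor_def v_def by simp
    qed
    ultimately show ?thesis by (simp add: tendsto_cong)
  qed
  have ffuv: "pair_factor w (v N) (u N) = 2 - pair_factor w (u N) (v N)" for N
    using minus_divide_right[of "w * u N * v N" "(u N)\<^sup>2 - (v N)\<^sup>2"] by (simp add: pair_factor_def mult_ac)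
  have lim: "(\<lambda>N.
       (h (k - 2) * ((\<Prod>i\<in>I. pair_factor w (x i) (u N)) * (\<Prod>i\<in>I. pair_factor w (x i) (v N))) +
        h (k + 2) * ((\<Prod>j\<in>S - I. pair_factor w (u N) (x j)) * (\<Prod>j\<in>S - I. pair_factor w (v N) (x j))) -
        h k *
          (pair_factor w (u N) (v N) * ((\<Prod>j\<in>S - I. pair_factor w (u N) (x j)) * (\<Prod>i\<in>I. pair_factor w (x i) (v N))) +
           pair_factor w (v N) (u N) * ((\<Prod>j\<in>S - I. pair_factor w (v N) (x j)) * (\<Prod>i\<in>I. pair_factor w (x i) (u N))))))
     \<longlonglongrightarrow> h (k - 2) + h (k + 2) - (2 - w\<^sup>2 * s) * h k" if "I \<in> Pow S" for I k
  proof -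
    have f: "finite I" "finite (S - I)" using that assms(1) finite_subset by auto
    have s: "s = (\<Sum>i\<in>I. x i) + (\<Sum>i\<in>S - I. x i)"
      unfolding s_def using sum.subset_diff[of I S x] that assms(1) by (simp add: add.commute)
    note pu = tendsto_scaled_prod[OF f(2) lu(1)] tendsto_scaled_prod[OF f(1) lu(2)]
    note pv = tendsto_scaled_prod[OF f(2) lv(1)] tendsto_scaled_prod[OF f(1) lv(2)]
    note p1 = pu[THEN tendsto_1_if_scaled] pv[THEN tendsto_1_if_scaled]
    \<comment> \<open>A product of two factors is read as a product over the two booleans.\<close>
    have two: "(\<lambda>N. of_nat N * (f N * g N - 1)) \<longlonglongrightarrow> A + B"
      if "(\<lambda>N. of_nat N * (f N - 1)) \<longlonglongrightarrow> A" "(\<lambda>N. of_nat N * (g N - 1)) \<longlonglongrightarrow> B"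
      for f g :: "nat \<Rightarrow> complex" and A B
      using tendsto_scaled_prod[of "{False, True}" "\<lambda>N i. if i then f N else g N" "\<lambda>i. if i then A else B"] that
      by (simp add: add.commute mult.commute)
    define X where "X N = (\<Prod>j\<in>S - I. pair_factor w (u N) (x j)) * (\<Prod>i\<in>I. pair_factor w (x i) (v N))" for N
    define Y where "Y N = (\<Prod>j\<in>S - I. pair_factor w (v N) (x j)) * (\<Prod>i\<in>I. pair_factor w (x i) (u N))" for N
    \<comment> \<open>The parts over \<open>I\<close> and \<open>S - I\<close> have equal sign and
      combine to the full sum \<open>s\<close>, so the limit does not depend on
      \<open>I\<close>.\<close>
    have X: "(\<lambda>N. of_nat N * (X N - 1)) \<longlonglongrightarrow> - (w * s)"
      unfolding X_def using two[OF pu(1) pv(2)]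
      by (simp add: s sum_distrib_left sum_negf algebra_simps)
    have Y: "(\<lambda>N. of_nat N * (Y N - 1)) \<longlonglongrightarrow> w * s"
      unfolding Y_def using two[OF pv(1) pu(2)]
      by (simp add: s sum_distrib_left sum_negf algebra_simps)
    \<comment> \<open>With f the factor of (u, v) and 2 - f that of (v, u), f X + (2 - f) Y = X + Y
      + (f - 1) (X - Y). Here f - 1 grows like w N / 2, and N (X - Y) tends to -2 w s.\<close>
    have "(\<lambda>N. X N + Y N + (pair_factor w (u N) (v N) - 1) * (1 / of_nat N) * (of_nat N * (X N - 1) - of_nat N * (Y N - 1)))
        \<longlonglongrightarrow> 1 + 1 + w / 2 * (- (w * s) - w * s)"
      by (intro tendsto_intros g X Y tendsto_1_if_scaled[OF X] tendsto_1_if_scaled[OF Y])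
    moreover have "\<forall>\<^sub>F N in sequentially.
        X N + Y N + (pair_factor w (u N) (v N) - 1) * (1 / of_nat N) * (of_nat N * (X N - 1) - of_nat N * (Y N - 1))
        = pair_factor w (u N) (v N) * X N + pair_factor w (v N) (u N) * Y N"
      using eventually_gt_at_top[of 0] by eventually_elim (simp add: ffuv field_simps)
    ultimately have "(\<lambda>N. pair_factor w (u N) (v N) * X N + pair_factor w (v N) (u N) * Y N)
        \<longlonglongrightarrow> 1 + 1 + w / 2 * (- (w * s) - w * s)"
      by (rule Lim_transform_eventually)
    then have XY: "(\<lambda>N. pair_factor w (u N) (v N) * X N + pair_factor w (v N) (u N) * Y N) \<longlonglongrightarrow> 2 - w\<^sup>2 * s"
      by (simp add: power2_eq_square algebra_simps)
    have "(\<lambda>N.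
       (h (k - 2) * ((\<Prod>i\<in>I. pair_factor w (x i) (u N)) * (\<Prod>i\<in>I. pair_factor w (x i) (v N))) +
        h (k + 2) * ((\<Prod>j\<in>S - I. pair_factor w (u N) (x j)) * (\<Prod>j\<in>S - I. pair_factor w (v N) (x j))) -
        h k * (pair_factor w (u N) (v N) * X N + pair_factor w (v N) (u N) * Y N)))
        \<longlonglongrightarrow> h (k - 2) * (1 * 1) + h (k + 2) * (1 * 1) - h k * (2 - w\<^sup>2 * s)"
      by (intro tendsto_intros p1 XY)
    then show ?thesis unfolding X_def Y_def by (simp add: mult.commute)
  qed
  have cp: "cross_prod w (x(a := y, b := z)) I (S - I) = cross_prod w x I (S - I)" if "I \<in> Pow S" for I y z
    using that assms(2,3) by (subst cross_prod_upd, auto)+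
  have pr: "(\<Prod>i\<in>I. G ((x(a := y, b := z)) i)) = (\<Prod>i\<in>I. G (x i))" if "I \<subseteq> S" for I y z and G :: "complex \<Rightarrow> complex"
    using that assms(2,3) by (intro prod.cong) auto
  show ?thesis
    unfolding subset_sum_insert2[OF assms] unfolding subset_sum_def
  proof (intro tendsto_sum, goal_cases)
    case (1 I)
    have I: "I \<subseteq> S" "S - I \<subseteq> S" using 1 by auto
    have ab: "(x(a := y, b := z)) a = y" "(x(a := y, b := z)) b = z" for y z using assms(4) by auto
    show ?case
      unfolding cp[OF 1] ab
        pr[OF I(1), of "\<lambda>y. pair_factor w y _"] pr[OF I(2), of "pair_factor w _"]
      using tendsto_mult[OF tendsto_const lim[OF 1]] unfolding u_def v_def s_def .
  qed
qed

section \<open>Induction on the number of variables\<close>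

lemma defect_empty: "defect q x {} = 0"
  by (simp add: defect_def subset_sum_empty)

lemma defect_singleton: "x a \<noteq> 0 \<Longrightarrow> defect q x {a} = 0"
  by (simp add: defect_def subset_sum_singleton Let_def power_int_minus algebra_simps)

text \<open>Adding the shifts by -2 and 2 multiplies the powers of q by w^2 + 2 and the weight k by
  2. The power sums thus acquire w^2 (1 + P), the linear one only w^2 P. The total of the variables,
  1 + P, supplies the missing factor, and its old value P is absorbed into the smaller
  defect.\<close>

lemma defect_limit:
  assumes "finite S" "a \<notin> S" "b \<notin> S" "a \<noteq> b" "q \<noteq> 0"
  shows "(\<lambda>N. defect q (x(a := 1 - of_nat N, b := of_nat N)) (insert a (insert b S)))
    \<longlonglongrightarrow> (q - inverse q)\<^sup>2 * (1 + (\<Sum>i\<in>S. x i)) * defect q x S"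
proof -
  define w where "w = q - inverse q"
  define P where "P = (\<Sum>i\<in>S. x i)"
  define M where "M = (\<Sum>i\<in>S. inverse (x i))"
  define y where "y N = x(a := 1 - of_nat N, b := of_nat N)" for N
  define T where "T = insert a (insert b S)"
  note lim = subset_sum_limit[OF assms(1-4), of w x, folded T_def P_def y_def]
  have P: "(\<Sum>i\<in>T. y N i) = 1 + P" for N
    unfolding T_def P_def y_def using assms(1-4) by (auto intro!: sum.cong)
  have M: "(\<Sum>i\<in>T. inverse (y N i)) = inverse (1 - of_nat N) + inverse (of_nat N) + M" for N
    unfolding T_def M_def y_def using assms(1-4) by (auto intro!: sum.cong)
  have inv: "(\<lambda>N. inverse (of_nat N)) \<longlonglongrightarrow> (0::complex)"
    using lim_1_over_n by (simp add: inverse_eq_divide)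
  have q2: "q powi (k - 2) + q powi (k + 2) = (w\<^sup>2 + 2) * q powi k" for k
    using assms(5) by (simp add: power_int_diff power_int_add w_def power2_eq_square field_simps)
  have 1: "subset_sum w x S (\<lambda>k. q powi (k - 2) + q powi (k + 2) - (2 - w\<^sup>2 * P) * q powi k)
      = w\<^sup>2 * (1 + P) * subset_sum w x S (\<lambda>k. q powi k)"
    unfolding q2 subset_sum_scale[symmetric] by (simp add: algebra_simps)
  have q3: "q powi (- (k - 2)) + q powi (- (k + 2)) = (w\<^sup>2 + 2) * q powi (- k)" for k
    using q2[of "- k"] by (simp add: algebra_simps)
  have 2: "subset_sum w x S (\<lambda>k. q powi (- (k - 2)) + q powi (- (k + 2)) - (2 - w\<^sup>2 * P) * q powi (- k))
      = w\<^sup>2 * (1 + P) * subset_sum w x S (\<lambda>k. q powi (- k))"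
    unfolding q3 subset_sum_scale[symmetric] by (simp add: algebra_simps)
  have 3: "subset_sum w x S (\<lambda>k. of_int (k - 2) + of_int (k + 2) - (2 - w\<^sup>2 * P) * of_int k)
      = w\<^sup>2 * P * subset_sum w x S of_int"
    unfolding subset_sum_scale[symmetric] by (simp add: algebra_simps)
  have "(\<lambda>N. subset_sum w (y N) T (\<lambda>k. q powi k) - subset_sum w (y N) T (\<lambda>k. q powi (- k))
      - w * (1 + P) * (inverse (1 - of_nat N) + inverse (of_nat N) + M) * subset_sum w (y N) T of_int)
      \<longlonglongrightarrow> w\<^sup>2 * (1 + P) * subset_sum w x S (\<lambda>k. q powi k) - w\<^sup>2 * (1 + P) * subset_sum w x S (\<lambda>k. q powi (- k))
         - w * (1 + P) * (0 + 0 + M) * (w\<^sup>2 * P * subset_sum w x S of_int)"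
    using lim[of "\<lambda>k. q powi k"] lim[of "\<lambda>k. q powi (- k)"] lim[of of_int]
    unfolding 1 2 3 by (intro tendsto_intros inv lim_inverse_one_minus_nat)
  then show ?thesis
    unfolding defect_def Let_def y_def[symmetric] T_def[symmetric] P M
    unfolding w_def[symmetric] P_def[symmetric] M_def[symmetric]
    by (simp add: algebra_simps)
qed

text \<open>The induction leaves \<open>x\<close> arbitrary, since the smaller identity is also
  applied at points whose coordinates have been moved.\<close>

lemma defect_eq_0:
  fixes x :: "'i \<Rightarrow> complex"
  assumes "finite S" "regular x S" "q \<noteq> 0"
  shows "defect q x S = 0"
  using assms
proof (induction "card S" arbitrary: S x rule: less_induct)
  case less
  show ?case
  proof (cases "card S < 2")
    case True
    then consider "S = {}" | a where "S = {a}"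
      using less.prems(1) by (metis card_1_singletonE card_eq_0_iff less_2_cases One_nat_def)
    then show ?thesis
      using less.prems by cases (auto simp: defect_empty defect_singleton regular_def)
  next
    case False
    then obtain T where T: "T \<subseteq> S" "card T = 2"
      using obtain_subset_with_card_n[of 2 S] by (metis not_less)
    then obtain a b where ab: "T = {a, b}" "a \<noteq> b" by (meson card_2_iff)
    define R where "R = S - T"
    have S: "S = insert a (insert b R)" "finite R" "a \<notin> R" "b \<notin> R"
      using T ab less.prems(1) by (auto simp: R_def)
    have small: "defect q y U = 0" if "card U < card S" "finite U" "regular y U"
      for y :: "'i \<Rightarrow> complex" and U
      using less.hyps[OF that less.prems(3)] .
    define z where "z N = x(a := 1 - of_nat N, b := of_nat N)" for N :: nat
    \<comment> \<open>Moving one coordinate between regular points does not change the defect: the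
      hypotheses of \<open>defect_constant\<close> concern fewer variables.\<close>
    have const: "defect q y S = defect q (y(c := t)) S"
      if "c \<in> S" "regular y S" "regular (y(c := t)) S" for y c t
    proof -
      define U where "U = S - {c}"
      have U: "insert c U = S" "c \<notin> U" "finite U" "regular y U" "card U < card S" "U \<noteq> {}"
        using that(1) less.prems(1) regular_subset[OF that(2), of U] S(1) ab(2) card_Diff1_less[of S c]
        by (auto simp: U_def)
      have "defect q y (U - {r}) = 0" for r
        using small[of "U - {r}" y] U regular_subset[of y U "U - {r}"] card_mono[of U "U - {r}"] by auto
      then obtain k where "\<And>u. regular (y(c := u)) (insert c U) \<Longrightarrow> defect q (y(c := u)) (insert c U) = k"
        using defect_constant[OF U(3,6,2,4)] by metis
      from this[of t] this[of "y c"] show ?thesis using that U(1) by simp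
    qed
    \<comment> \<open>For N > B + 1 the moduli N and N - 1 of the new coordinates differ and exceed
      every |x_i|. Different moduli give different squares, hence regularity.\<close>
    define B where "B = 1 + (\<Sum>i\<in>S. norm (x i))"
    have B: "norm (x i) \<le> B - 1" if "i \<in> S" for i
      unfolding B_def using member_le_sum[OF that, of "\<lambda>i. norm (x i)"] less.prems(1) by simp
    have sq: "y\<^sup>2 \<noteq> z\<^sup>2" if "norm y \<noteq> norm z" for y z :: complex
      using that by (metis norm_power norm_ge_zero power2_eq_imp_eq)
    have "\<forall>\<^sub>F N in sequentially. defect q (z N) S = defect q x S"
      using eventually_gt_at_top[of "nat \<lceil>B + 1\<rceil>"]
    proof eventually_elim
      case (elim N)
      then have N: "real N > B + 1" by linarith
      have B1: "B \<ge> 1" unfolding B_def by (simp add: sum_nonneg)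
      have n1: "norm (of_nat N :: complex) = real N" by simp
      have n2: "norm (1 - of_nat N :: complex) = real N - 1"
        using N B1 norm_of_real[of "1 - real N", where 'a = complex] by simp
      have big: "\<And>i. i \<in> S \<Longrightarrow> norm (x i) < real N - 1" using B N by force
      have "norm (of_nat N :: complex) > 0" "norm (1 - of_nat N :: complex) > 0"
        unfolding n1 n2 using N B1 by linarith+
      then have nz: "of_nat N \<noteq> (0::complex)" "1 - of_nat N \<noteq> (0::complex)"
        unfolding zero_less_norm_iff .
      have ne: "(of_nat N)\<^sup>2 \<noteq> (x i)\<^sup>2" "(1 - of_nat N)\<^sup>2 \<noteq> (x i)\<^sup>2" if "i \<in> insert a (insert b R)" for i
        using big[of i] that n1 n2 unfolding S(1) by (intro sq; linarith)+
      have ne': "(1 - of_nat N)\<^sup>2 \<noteq> (of_nat N :: complex)\<^sup>2"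
        by (rule sq) (use n1 n2 in linarith)
      have a: "a \<notin> insert b R" using S(3) ab(2) by simp
      have reg: "regular x (insert b R)" "regular x R"
        using regular_subset[OF less.prems(2)] S(1) by auto
      have "regular (x(a := 1 - of_nat N)) (insert b R)"
        using reg(1) regular_cong[of "insert b R" "x(a := 1 - of_nat N)" x] a by (metis fun_upd_other)
      then have r1: "regular (x(a := 1 - of_nat N)) S"
        unfolding S(1) regular_insert[OF a] using a nz(2) ne(2) by (auto simp del: power2_eq_iff)
      have "regular (z N) R"
        using reg(2) regular_cong[of R "z N" x] S(3,4) unfolding z_def by (metis fun_upd_other)
      moreover have "z N b = of_nat N" "z N a = 1 - of_nat N" "\<And>i. i \<in> R \<Longrightarrow> z N i = x i"
        using S(3,4) ab(2) by (auto simp: z_def)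
      ultimately have r2: "regular (z N) S"
        unfolding S(1) regular_insert[OF a] regular_insert[OF S(4)]
        using nz ne ne' by (simp del: power2_eq_iff)
      \<comment> \<open>The coordinates are moved one at a time; the intermediate point still
        carries the old x_b and must be regular too.\<close>
      have "defect q x S = defect q (x(a := 1 - of_nat N)) S"
        using const[of a x] r1 less.prems(2) S(1) by simp
      also have "\<dots> = defect q (z N) S"
        using const[of b "x(a := 1 - of_nat N)" "of_nat N"] r1 r2 S(1) by (simp add: z_def)
      finally show ?case by simp
    qed
    then have "(\<lambda>N. defect q (z N) S) \<longlonglongrightarrow> defect q x S"
      by (simp add: tendsto_eventually)
    \<comment> \<open>The limit is a multiple of the defect of \<open>R\<close>, which has two
      variables fewer.\<close>
    moreover have "(\<lambda>N. defect q (z N) S) \<longlonglongrightarrow> 0"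
    proof -
      have "card R < card S" using S ab(2) by simp
      then have "defect q x R = 0"
        using small[of R x] S regular_subset[OF less.prems(2), of R] by auto
      then show ?thesis
        using defect_limit[OF S(2-4) ab(2) less.prems(3), of x] unfolding z_def S(1) by simp
    qed
    ultimately show ?thesis by (rule LIMSEQ_unique)
  qed
qed

section \<open>The form factors\<close>

text \<open>Each pair with exactly one member in \<open>I\<close> occurs once on the left.
  Relabelling the pairs whose larger index is in \<open>I\<close> puts that member first.\<close>

lemma prod_ordered_pairs:
  fixes G :: "nat \<Rightarrow> nat \<Rightarrow> 'b::comm_monoid_mult"
  assumes "I \<subseteq> {1..n}"
  shows "(\<Prod>i = 1..n. \<Prod>j\<in>{i<..n}.
      if i \<in> I \<and> j \<notin> I then G i j else if i \<notin> I \<and> j \<in> I then G j i else 1)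
    = (\<Prod>i\<in>I. \<Prod>j\<in>{1..n} - I. G i j)"
proof -
  \<comment> \<open>\<open>A\<close> carries the pairs whose smaller index lies in \<open>I\<close>,
    \<open>B\<close> those whose larger index does.\<close>
  define A where "A i j = (if i < j \<and> i \<in> I \<and> j \<notin> I then G i j else 1)" for i j
  define B where "B i j = (if i < j \<and> i \<notin> I \<and> j \<in> I then G j i else 1)" for i j
  have "(\<Prod>i = 1..n. \<Prod>j\<in>{i<..n}.
      if i \<in> I \<and> j \<notin> I then G i j else if i \<notin> I \<and> j \<in> I then G j i else 1)
      = (\<Prod>i = 1..n. \<Prod>j = 1..n. A i j * B i j)"
    unfolding A_def B_def by (intro prod.cong[OF refl] prod.mono_neutral_cong_left) auto
  also have "\<dots> = (\<Prod>i = 1..n. \<Prod>j = 1..n. A i j) * (\<Prod>i = 1..n. \<Prod>j = 1..n. B i j)"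
    by (simp add: prod.distrib)
  also have "(\<Prod>i = 1..n. \<Prod>j = 1..n. B i j) = (\<Prod>i = 1..n. \<Prod>j = 1..n. B j i)"
    by (rule prod.swap)
  also have "(\<Prod>i = 1..n. \<Prod>j = 1..n. A i j) * \<dots> =
      (\<Prod>i = 1..n. \<Prod>j = 1..n. if i \<in> I \<and> j \<notin> I then G i j else 1)"
    unfolding prod.distrib[symmetric] A_def B_def
    by (intro prod.cong refl) (auto simp: not_less_iff_gr_or_eq)
  also have "\<dots> = (\<Prod>i\<in>I. \<Prod>j = 1..n. if j \<notin> I then G i j else 1)"
    using assms by (intro prod.mono_neutral_cong_right) auto
  also have "\<dots> = (\<Prod>i\<in>I. \<Prod>j\<in>{1..n} - I. G i j)"
    by (intro prod.cong[OF refl] prod.mono_neutral_cong_right) auto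
  finally show ?thesis .
qed

text \<open>For a, b replaced by their exponentials, the denominator is exp a exp b times 2 sinh (a
  - b). If sinh vanishes, both quotients take the default value 0.\<close>

lemma pair_factor_exp:
  "pair_factor (2 * \<i> * s) (exp a) (exp b) = 1 + \<i> * s / sinh (a - b)"
proof -
  have "exp a * exp b * (2 * sinh (a - b)) = (exp a)\<^sup>2 - (exp b)\<^sup>2"
    by (simp add: sinh_field_def exp_diff exp_minus field_simps power2_eq_square)
  then show ?thesis by (simp add: pair_factor_def mult.assoc[symmetric] flip: \<open>_ = (exp a)\<^sup>2 - (exp b)\<^sup>2\<close>)
qed

text \<open>A choice of l is the indicator of \<open>I\<close>. The difference l_i - l_j is nonzero
  only for separated pairs, and its value -1 is absorbed by the oddness of sinh, which reverses the
  pair.\<close>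

lemma K_fun_eq_subset_sum:
  assumes "\<And>l. l \<in> {1..n} \<rightarrow>\<^sub>E {0, 1} \<Longrightarrow>
    p l \<theta> = h (2 * int (\<Sum>i = 1..n. l i) - int n)"
  shows "K_fun \<nu> n p \<theta> = subset_sum (2 * \<i> * complex_of_real (sin (pi * \<nu>))) (\<lambda>i. exp (\<theta> i)) {1..n} h"
  unfolding K_fun_def subset_sum_def
\<comment> \<open>The indicator is restricted to {1..n} because members of the extensional function
  space are \<open>undefined\<close> elsewhere.\<close>
proof (rule sum.reindex_bij_witness[where i = "\<lambda>I. \<lambda>i\<in>{1..n}. if i \<in> I then 1 else 0"
      and j = "\<lambda>l. {i\<in>{1..n}. l i = 1}"], goal_cases)
  case (1 l)
  then show ?case by (auto simp: PiE_def extensional_def fun_eq_iff Pi_def restrict_def)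
next
  case (5 l)
  define I where "I = {i\<in>{1..n}. l i = 1}"
  have l: "l i = (if i \<in> I then 1 else 0)" if "i \<in> {1..n}" for i
    using 5 that by (auto simp: I_def PiE_def Pi_def)
  have "(\<Sum>i = 1..n. l i) = (\<Sum>i = 1..n. if i \<in> I then 1 else 0)"
    using l by (intro sum.cong) auto
  also have "\<dots> = card I"
    using sum.inter_filter[of "{1..n}" "\<lambda>_. 1 :: nat" "\<lambda>i. l i = 1"] by (simp add: I_def)
  finally have c: "(\<Sum>i = 1..n. l i) = card I" .
  have "(\<Prod>i = 1..n. \<Prod>j\<in>{i<..n}. 1 + (of_nat (l i) - of_nat (l j))
        * (\<i> * complex_of_real (sin (pi * \<nu>)) / sinh (\<theta> i - \<theta> j)))
    = (\<Prod>i = 1..n. \<Prod>j\<in>{i<..n}.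
        if i \<in> I \<and> j \<notin> I then pair_factor (2 * \<i> * complex_of_real (sin (pi * \<nu>))) (exp (\<theta> i)) (exp (\<theta> j))
        else if i \<notin> I \<and> j \<in> I then pair_factor (2 * \<i> * complex_of_real (sin (pi * \<nu>))) (exp (\<theta> j)) (exp (\<theta> i)) else 1)"
  proof (intro prod.cong refl, goal_cases)
    case (1 i j)
    have "sinh (\<theta> j - \<theta> i) = - sinh (\<theta> i - \<theta> j)"
      by (metis minus_diff_eq sinh_minus)
    then show ?case using l[of i] l[of j] 1 by (auto simp: pair_factor_exp)
  qed
  also have "\<dots> = cross_prod (2 * \<i> * complex_of_real (sin (pi * \<nu>))) (\<lambda>i. exp (\<theta> i)) I ({1..n} - I)"
    unfolding cross_prod_def by (rule prod_ordered_pairs) (auto simp: I_def)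
  finally show ?case
    unfolding assms[OF 5] c by (simp add: I_def mult.assoc)
qed auto

text \<open>The meromorphic identity is stated pointwise, away from the zeros of sinh in the
  denominators of \<open>K_fun\<close>.\<close>

theorem mainTheorem1:
  fixes \<beta> m \<alpha> :: real and n :: nat and \<theta> :: "nat \<Rightarrow> complex"
  assumes "0 < \<beta>\<^sup>2" and "\<beta>\<^sup>2 < 4 * pi" and "0 < m"
    and "\<alpha> = m\<^sup>2 * (pi * nu \<beta> / sin (pi * nu \<beta>))"
    and "\<And>i j. 1 \<le> i \<Longrightarrow> i < j \<Longrightarrow> j \<le> n \<Longrightarrow> sinh (\<theta> i - \<theta> j) \<noteq> 0"
  shows "- (complex_of_real m)\<^sup>2 * (\<Sum>i = 1..n. exp (\<theta> i)) * (\<Sum>i = 1..n. exp (- \<theta> i)) * f_phi \<beta> n \<theta>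
         + complex_of_real (\<alpha> / \<beta>) * f_sin \<beta> n \<theta> = 0"
proof (cases "n = 0")
  case True
  \<comment> \<open>For n = 0 the sums over rapidities are empty, and the two exponentials both have
    form factor 1 and cancel.\<close>
  then show ?thesis by (simp add: f_sin_def f_exp_def)
next
  case False
  define \<nu> where "\<nu> = nu \<beta>"
  have \<beta>: "\<beta> \<noteq> 0" using assms(1) by auto
  have D: "0 < 8 * pi - \<beta>\<^sup>2" using assms(2) pi_gt_zero by linarith
  have \<nu>: "0 < \<nu>" "\<nu> < 1"
    unfolding \<nu>_def nu_def using D assms(1,2) divide_pos_pos[OF assms(1) D]
      divide_less_eq_1_pos[OF D, of "\<beta>\<^sup>2"] by linarith+
  have sin: "sin (pi * \<nu>) > 0" using \<nu> by (intro sin_gt_zero) auto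
  define w where "w = 2 * \<i> * complex_of_real (sin (pi * \<nu>))"
  define q where "q = exp (\<i> * complex_of_real (pi * \<nu>))"
  define x where "x i = exp (\<theta> i)" for i
  define W' where "W' = subset_sum w x {1..n}"
  have w: "w = q - inverse q"
    unfolding w_def q_def by (simp add: exp_minus[symmetric] sin_of_real[symmetric] sin_exp_eq)
  \<comment> \<open>Equal squares would force sinh (\<theta>_i - \<theta>_j) = 0.\<close>
  have sq: "(x i)\<^sup>2 \<noteq> (x j)\<^sup>2" if "1 \<le> i" "i < j" "j \<le> n" for i j
  proof
    assume "(x i)\<^sup>2 = (x j)\<^sup>2"
    then have "exp (\<theta> i - \<theta> j) = exp (- (\<theta> i - \<theta> j))"
      by (simp add: x_def exp_diff exp_minus field_simps power2_eq_square)
    then show False using assms(5)[OF that] by (simp add: sinh_field_def)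
  qed
  have reg: "regular x {1..n}"
    unfolding regular_def inj_on_def
  proof (intro conjI ballI impI)
    fix i j assume "i \<in> {1..n}" "j \<in> {1..n}" "(x i)\<^sup>2 = (x j)\<^sup>2"
    then show "i = j" using sq[of i j] sq[of j i] by (metis atLeastAtMost_iff linorder_neqE_nat)
  qed (simp add: x_def)
  have prod_exp: "(\<Prod>i = 1..n. exp ((2 * of_nat (l i) - 1) * C)) =
      exp (of_int (2 * int (\<Sum>i = 1..n. l i) - int n) * C)" for l :: "nat \<Rightarrow> nat" and C :: complex
    by (simp add: exp_sum[symmetric] sum_distrib_right[symmetric] sum_subtractf sum_distrib_left)
  have p_exp: "p_exp \<beta> \<gamma> n l \<theta> =
      exp (of_int (2 * int (\<Sum>i = 1..n. l i) - int n) * (\<i> * complex_of_real (pi * \<nu> * \<gamma> / \<beta>)))" for \<gamma> l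
    unfolding p_exp_def \<nu>_def mult.assoc[of _ \<i>] by (rule prod_exp)
  \<comment> \<open>For \<gamma> = \<beta> the exponent is i pi \<nu> k, a power of
    \<open>q\<close>; the opposite sign of \<gamma> inverts it.\<close>
  have Kp: "K_fun \<nu> n (p_exp \<beta> \<beta> n) \<theta> = W' (\<lambda>k. q powi k)"
    unfolding W'_def w_def x_def
    by (rule K_fun_eq_subset_sum) (use \<beta> in \<open>simp add: p_exp q_def exp_power_int\<close>)
  have Km: "K_fun \<nu> n (p_exp \<beta> (- \<beta>) n) \<theta> = W' (\<lambda>k. q powi (- k))"
    unfolding W'_def w_def x_def
    by (rule K_fun_eq_subset_sum) (use \<beta> in \<open>simp add: p_exp q_def exp_power_int algebra_simps\<close>)
  have Kphi: "K_fun \<nu> n (p_phi n) \<theta> = W' of_int"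
    unfolding W'_def w_def x_def
    by (rule K_fun_eq_subset_sum) (simp add: p_phi_def sum_subtractf sum_distrib_left)
  have "defect q x {1..n} = 0"
    using defect_eq_0[of "{1..n}" x q] reg by (simp add: q_def)
  then have id: "W' (\<lambda>k. q powi k) - W' (\<lambda>k. q powi (- k)) =
      w * (\<Sum>i = 1..n. exp (\<theta> i)) * (\<Sum>i = 1..n. exp (- \<theta> i)) * W' of_int"
    unfolding defect_def Let_def w[symmetric] W'_def x_def by (simp add: exp_minus)
  \<comment> \<open>The product of the two-particle functions is common to both form
    factors.\<close>
  define \<Phi> where "\<Phi> = (\<Prod>i = 1..n. \<Prod>j\<in>{i<..n}. F_min \<nu> (\<theta> i - \<theta> j))"
  define P where "P = (\<Sum>i = 1..n. exp (\<theta> i)) * (\<Sum>i = 1..n. exp (- \<theta> i))"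
  define c where "c = sqrt (Z_phi \<nu>) * (\<beta> / (2 * pi * \<nu>))"
  have cn: "c ^ n = sqrt (Z_phi \<nu>) * (\<beta> / (2 * pi * \<nu>)) * c ^ (n - 1)"
    using False by (metis c_def power_eq_if)
  have "f_sin \<beta> n \<theta> = 1 / (2 * \<i>) * (complex_of_real (c ^ n) * (W' (\<lambda>k. q powi k) - W' (\<lambda>k. q powi (- k))) * \<Phi>)"
    using False by (simp add: f_sin_def f_exp_def general_form_def \<nu>_def[symmetric] Kp Km c_def \<Phi>_def algebra_simps)
  also have "\<dots> = (1 / (2 * \<i>) * w) * (complex_of_real (c ^ n) * P * W' of_int * \<Phi>)"
    unfolding id P_def by (simp only: mult_ac)
  also have "1 / (2 * \<i>) * w = complex_of_real (sin (pi * \<nu>))"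
    by (simp add: w_def)
  finally have fsin: "f_sin \<beta> n \<theta> =
      complex_of_real (sin (pi * \<nu>)) * (complex_of_real (c ^ n) * P * W' of_int * \<Phi>)" .
  have fphi: "f_phi \<beta> n \<theta> = complex_of_real (sqrt (Z_phi \<nu>) / 2 * c ^ (n - 1)) * W' of_int * \<Phi>"
    using False by (simp add: f_phi_def general_form_def \<nu>_def[symmetric] Kphi c_def \<Phi>_def)
  \<comment> \<open>Here the value of \<alpha> enters: its sine cancels the one from w / (2 i), and
    pi \<nu> / \<beta> cancels against the single factor split off from \<open>c ^ n\<close>,
    leaving the normalization of the field.\<close>
  have "\<alpha> / \<beta> * c ^ n * sin (pi * \<nu>) = m\<^sup>2 * (sqrt (Z_phi \<nu>) / 2 * c ^ (n - 1))"
    unfolding cn assms(4) \<nu>_def[symmetric] using sin \<nu> \<beta> by (simp add: field_simps)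
  then have coef: "complex_of_real (\<alpha> / \<beta>) * complex_of_real (c ^ n) * complex_of_real (sin (pi * \<nu>))
      = (complex_of_real m)\<^sup>2 * complex_of_real (sqrt (Z_phi \<nu>) / 2 * c ^ (n - 1))"
    by (metis of_real_mult of_real_power)
  have "complex_of_real (\<alpha> / \<beta>) * f_sin \<beta> n \<theta> = (complex_of_real (\<alpha> / \<beta>) * complex_of_real (c ^ n) * complex_of_real (sin (pi * \<nu>))) * P * W' of_int * \<Phi>"
    unfolding fsin by (simp only: mult_ac)
  also have "\<dots> = (complex_of_real m)\<^sup>2 * P * f_phi \<beta> n \<theta>"
    unfolding coef fphi by (simp only: mult_ac)
  finally show ?thesis unfolding P_def by (simp add: mult.assoc)
qed

end
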